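(* Let $k$ be an algebraically closed field of characteristic $0$. Let $R$ be an affine commutative Hopf $k$-algebra which is an integral domain, so that $R=\mathcal O(G)$ for a connected affine algebraic group $G$ over $k$. Let $T=R[x;\sigma,\delta]$ be a Hopf Ore extension of $R$ of variant type. Then: (i) there is a change of variables $x\mapsto\tilde x$ such that $T=R[\tilde x;\sigma]$; (ii) the indeterminate $\tilde x$ is skew primitive, and $\sigma$ is a winding automorphism of $R$ corresponding to a central element of $G$.
   Context: Hopf algebras have bijective antipode. A Hopf Ore extension of a Hopf algebra $R$ is a Hopf algebra $T$ containing $R$ as a Hopf subalgebra with $T=R[x;\sigma,\delta]$ (skew polynomial algebra: $xr-\sigma(r)x=\delta(r)$, $\sigma$ an algebra automorphism, $\delta$ a $\sigma$-derivation of $R$), and with $\Delta(x)=a\otimes x+x\otimes b+v(x\otimes x)+w$ for some $a,b\in R$, $v,w\in R\otimes R$. Let $\Xi(T)$ be the set of ideals $M$ of $T$ with $T/M\cong k$. The extension is of variant type if for every $M\in\Xi(T)$, $\mathfrak m=M\cap R$ satisfies $\sigma(\mathfrak m)\ne\mathfrak m$ and $\delta([R,R])\subseteq\mathfrak m$. An element $y$ is skew primitive if $\Delta(y)=g\otimes y+y\otimes h$ for group-like $g,h$. A winding automorphism of $\mathcal O(G)$ corresponding to $g\in G$ is $f\mapsto f(g\,\cdot)$ or $f\mapsto f(\cdot\, g)$, i.e. $\tau^\ell_g(f)=g(f_1)f_2$ or $\tau^r_g(f)=f_1g(f_2)$, viewing $g$ as a character. *)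

theory Defs
  imports "HOL-Computational_Algebra.Polynomial"
begin

text \<open>
Conventions. The base field is a type 'k of class field_char_0.
A k-algebra T is a type 'a of class ring_1 together with a central unital
ring homomorphism iota from 'k into 'a (the structure map); T is all of 'a.
The tensor product T (x) T over k is represented by finite lists of pairs
(finite sums of simple tensors); two lists denote the same tensor iff they
agree under all pairs of k-linear functionals (over a field the canonical map
from V (x) W to bilinear forms on dual(V) x dual(W) is injective, so this is
exactly equality in the tensor product). Likewise for triple tensors.
\<close>

definition alg_closed_field :: "'k::field itself \<Rightarrow> bool" where
  "alg_closed_field _ \<longleftrightarrow> (\<forall>p::'k poly. degree p > 0 \<longrightarrow> (\<exists>z. poly p z = 0))"

definition kalg :: "('k::field \<Rightarrow> 'a::ring_1) \<Rightarrow> bool" where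
  "kalg \<iota> \<longleftrightarrow> (\<forall>c d. \<iota> (c + d) = \<iota> c + \<iota> d) \<and> (\<forall>c d. \<iota> (c * d) = \<iota> c * \<iota> d)
     \<and> \<iota> 1 = 1 \<and> (\<forall>c a. \<iota> c * a = a * \<iota> c)"

definition klin_fun :: "('k::field \<Rightarrow> 'a::ring_1) \<Rightarrow> ('a \<Rightarrow> 'k) \<Rightarrow> bool" where
  "klin_fun \<iota> f \<longleftrightarrow> (\<forall>a b. f (a + b) = f a + f b) \<and> (\<forall>c a. f (\<iota> c * a) = c * f a)"

definition klin_end :: "('k::field \<Rightarrow> 'a::ring_1) \<Rightarrow> ('a \<Rightarrow> 'a) \<Rightarrow> bool" where
  "klin_end \<iota> S \<longleftrightarrow> (\<forall>a b. S (a + b) = S a + S b) \<and> (\<forall>c a. S (\<iota> c * a) = \<iota> c * S a)"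

definition tens_eq :: "('k::field \<Rightarrow> 'a::ring_1) \<Rightarrow> ('a \<times> 'a) list \<Rightarrow> ('a \<times> 'a) list \<Rightarrow> bool" where
  "tens_eq \<iota> xs ys \<longleftrightarrow> (\<forall>f g. klin_fun \<iota> f \<and> klin_fun \<iota> g \<longrightarrow>
      (\<Sum>(u, v)\<leftarrow>xs. f u * g v) = (\<Sum>(u, v)\<leftarrow>ys. f u * g v))"

definition tens3_eq :: "('k::field \<Rightarrow> 'a::ring_1) \<Rightarrow> ('a \<times> 'a \<times> 'a) list \<Rightarrow> ('a \<times> 'a \<times> 'a) list \<Rightarrow> bool" where
  "tens3_eq \<iota> xs ys \<longleftrightarrow> (\<forall>f g h. klin_fun \<iota> f \<and> klin_fun \<iota> g \<and> klin_fun \<iota> h \<longrightarrow>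
      (\<Sum>(u, v, w)\<leftarrow>xs. f u * g v * h w) = (\<Sum>(u, v, w)\<leftarrow>ys. f u * g v * h w))"

definition tens_mult :: "('a::ring_1 \<times> 'a) list \<Rightarrow> ('a \<times> 'a) list \<Rightarrow> ('a \<times> 'a) list" where
  "tens_mult xs ys = [(u * u', v * v'). (u, v) \<leftarrow> xs, (u', v') \<leftarrow> ys]"

definition hopf_alg :: "('k::field \<Rightarrow> 'a::ring_1) \<Rightarrow> ('a \<Rightarrow> ('a \<times> 'a) list) \<Rightarrow> ('a \<Rightarrow> 'k)
    \<Rightarrow> ('a \<Rightarrow> 'a) \<Rightarrow> bool" where
  "hopf_alg \<iota> \<Delta> \<epsilon> S \<longleftrightarrow>
     kalg \<iota>
   \<comment> \<open>Delta is a k-linear algebra map T -> T (x) T\<close>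
   \<and> (\<forall>a b. tens_eq \<iota> (\<Delta> (a + b)) (\<Delta> a @ \<Delta> b))
   \<and> (\<forall>c a. tens_eq \<iota> (\<Delta> (\<iota> c * a)) (map (\<lambda>(u, v). (\<iota> c * u, v)) (\<Delta> a)))
   \<and> (\<forall>a b. tens_eq \<iota> (\<Delta> (a * b)) (tens_mult (\<Delta> a) (\<Delta> b)))
   \<and> tens_eq \<iota> (\<Delta> 1) [(1, 1)]
   \<comment> \<open>coassociativity\<close>
   \<and> (\<forall>a. tens3_eq \<iota> [(u1, u2, v). (u, v) \<leftarrow> \<Delta> a, (u1, u2) \<leftarrow> \<Delta> u]
                        [(u, v1, v2). (u, v) \<leftarrow> \<Delta> a, (v1, v2) \<leftarrow> \<Delta> v])
   \<comment> \<open>eps is a k-algebra map T -> k, and the counit axioms\<close>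
   \<and> (\<forall>a b. \<epsilon> (a + b) = \<epsilon> a + \<epsilon> b) \<and> (\<forall>a b. \<epsilon> (a * b) = \<epsilon> a * \<epsilon> b)
   \<and> (\<forall>c. \<epsilon> (\<iota> c) = c)
   \<and> (\<forall>a. (\<Sum>(u, v)\<leftarrow>\<Delta> a. \<iota> (\<epsilon> u) * v) = a)
   \<and> (\<forall>a. (\<Sum>(u, v)\<leftarrow>\<Delta> a. u * \<iota> (\<epsilon> v)) = a)
   \<comment> \<open>S is a bijective k-linear antipode\<close>
   \<and> klin_end \<iota> S \<and> bij S
   \<and> (\<forall>a. (\<Sum>(u, v)\<leftarrow>\<Delta> a. S u * v) = \<iota> (\<epsilon> a))
   \<and> (\<forall>a. (\<Sum>(u, v)\<leftarrow>\<Delta> a. u * S v) = \<iota> (\<epsilon> a))"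

definition ksubalg :: "('k::field \<Rightarrow> 'a::ring_1) \<Rightarrow> 'a set \<Rightarrow> bool" where
  "ksubalg \<iota> A \<longleftrightarrow> range \<iota> \<subseteq> A \<and> (\<forall>a\<in>A. \<forall>b\<in>A. a + b \<in> A \<and> a * b \<in> A) \<and> (\<forall>a\<in>A. - a \<in> A)"

definition kgen :: "('k::field \<Rightarrow> 'a::ring_1) \<Rightarrow> 'a set \<Rightarrow> 'a set" where
  "kgen \<iota> F = \<Inter> {A. ksubalg \<iota> A \<and> F \<subseteq> A}"

definition affine_comm_domain :: "('k::field \<Rightarrow> 'a::ring_1) \<Rightarrow> 'a set \<Rightarrow> bool" where
  "affine_comm_domain \<iota> R \<longleftrightarrow> ksubalg \<iota> R
     \<and> (\<exists>F. finite F \<and> F \<subseteq> R \<and> R = kgen \<iota> F)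
     \<and> (\<forall>r\<in>R. \<forall>s\<in>R. r * s = s * r)
     \<and> (1::'a) \<noteq> 0 \<and> (\<forall>r\<in>R. \<forall>s\<in>R. r * s = 0 \<longrightarrow> r = 0 \<or> s = 0)"

definition in_tensR :: "('k::field \<Rightarrow> 'a::ring_1) \<Rightarrow> 'a set \<Rightarrow> ('a \<times> 'a) list \<Rightarrow> bool" where
  "in_tensR \<iota> R t \<longleftrightarrow> (\<exists>ys. set ys \<subseteq> R \<times> R \<and> tens_eq \<iota> t ys)"

definition hopf_subalg :: "('k::field \<Rightarrow> 'a::ring_1) \<Rightarrow> ('a \<Rightarrow> ('a \<times> 'a) list)
    \<Rightarrow> ('a \<Rightarrow> 'a) \<Rightarrow> 'a set \<Rightarrow> bool" where
  "hopf_subalg \<iota> \<Delta> S R \<longleftrightarrow> ksubalg \<iota> R \<and> (\<forall>r\<in>R. in_tensR \<iota> R (\<Delta> r)) \<and> S ` R \<subseteq> R"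

definition ore_ext :: "('k::field \<Rightarrow> 'a::ring_1) \<Rightarrow> 'a set \<Rightarrow> 'a \<Rightarrow> ('a \<Rightarrow> 'a) \<Rightarrow> ('a \<Rightarrow> 'a) \<Rightarrow> bool" where
  "ore_ext \<iota> R x \<sigma> \<delta> \<longleftrightarrow>
     \<comment> \<open>sigma is a k-algebra automorphism of R\<close>
     bij_betw \<sigma> R R
   \<and> (\<forall>r\<in>R. \<forall>s\<in>R. \<sigma> (r + s) = \<sigma> r + \<sigma> s \<and> \<sigma> (r * s) = \<sigma> r * \<sigma> s)
   \<and> (\<forall>c. \<sigma> (\<iota> c) = \<iota> c)
     \<comment> \<open>delta is a (k-linear) sigma-derivation of R\<close>
   \<and> \<delta> ` R \<subseteq> R
   \<and> (\<forall>r\<in>R. \<forall>s\<in>R. \<delta> (r + s) = \<delta> r + \<delta> s \<and> \<delta> (r * s) = \<sigma> r * \<delta> s + \<delta> r * s)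
   \<and> (\<forall>c. \<forall>r\<in>R. \<delta> (\<iota> c * r) = \<iota> c * \<delta> r)
     \<comment> \<open>commutation rule\<close>
   \<and> (\<forall>r\<in>R. x * r - \<sigma> r * x = \<delta> r)
     \<comment> \<open>T is free as a left R-module on the powers of x\<close>
   \<and> (\<forall>t. \<exists>n rs. (\<forall>i<n. rs i \<in> R) \<and> t = (\<Sum>i<n. rs i * x ^ i))
   \<and> (\<forall>n rs. (\<forall>i<n. rs i \<in> R) \<and> (\<Sum>i<n. rs i * x ^ i) = 0 \<longrightarrow> (\<forall>i<n. rs i = 0))"

definition hopf_ore_ext :: "('k::field \<Rightarrow> 'a::ring_1) \<Rightarrow> ('a \<Rightarrow> ('a \<times> 'a) list) \<Rightarrow> ('a \<Rightarrow> 'k)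
    \<Rightarrow> ('a \<Rightarrow> 'a) \<Rightarrow> 'a set \<Rightarrow> 'a \<Rightarrow> ('a \<Rightarrow> 'a) \<Rightarrow> ('a \<Rightarrow> 'a) \<Rightarrow> bool" where
  "hopf_ore_ext \<iota> \<Delta> \<epsilon> S R x \<sigma> \<delta> \<longleftrightarrow>
     hopf_alg \<iota> \<Delta> \<epsilon> S \<and> hopf_subalg \<iota> \<Delta> S R \<and> ore_ext \<iota> R x \<sigma> \<delta>
   \<and> (\<exists>a\<in>R. \<exists>b\<in>R. \<exists>v w. set v \<subseteq> R \<times> R \<and> set w \<subseteq> R \<times> R \<and>
        tens_eq \<iota> (\<Delta> x) ([(a, x), (x, b)] @ [(u * x, u' * x). (u, u') \<leftarrow> v] @ w))"

text \<open>Xi(T): ideals M of T with T/M isomorphic to k (as k-algebras), i.e. kernels of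
  k-algebra homomorphisms T -> k\<close>
definition kalg_hom_to_k :: "('k::field \<Rightarrow> 'a::ring_1) \<Rightarrow> ('a \<Rightarrow> 'k) \<Rightarrow> bool" where
  "kalg_hom_to_k \<iota> \<phi> \<longleftrightarrow> (\<forall>a b. \<phi> (a + b) = \<phi> a + \<phi> b \<and> \<phi> (a * b) = \<phi> a * \<phi> b)
     \<and> (\<forall>c. \<phi> (\<iota> c) = c)"

definition Xi :: "('k::field \<Rightarrow> 'a::ring_1) \<Rightarrow> 'a set set" where
  "Xi \<iota> = {M. \<exists>\<phi>. kalg_hom_to_k \<iota> \<phi> \<and> M = {t. \<phi> t = 0}}"

definition variant_type :: "('k::field \<Rightarrow> 'a::ring_1) \<Rightarrow> 'a set \<Rightarrow> ('a \<Rightarrow> 'a) \<Rightarrow> ('a \<Rightarrow> 'a) \<Rightarrow> bool" where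
  "variant_type \<iota> R \<sigma> \<delta> \<longleftrightarrow> (\<forall>M\<in>Xi \<iota>.
      \<sigma> ` (M \<inter> R) \<noteq> M \<inter> R \<and> \<delta> ` {r * s - s * r | r s. r \<in> R \<and> s \<in> R} \<subseteq> M \<inter> R)"

definition grouplike :: "('k::field \<Rightarrow> 'a::ring_1) \<Rightarrow> ('a \<Rightarrow> ('a \<times> 'a) list) \<Rightarrow> 'a \<Rightarrow> bool" where
  "grouplike \<iota> \<Delta> g \<longleftrightarrow> g \<noteq> 0 \<and> tens_eq \<iota> (\<Delta> g) [(g, g)]"

definition skew_primitive :: "('k::field \<Rightarrow> 'a::ring_1) \<Rightarrow> ('a \<Rightarrow> ('a \<times> 'a) list) \<Rightarrow> 'a \<Rightarrow> bool" where
  "skew_primitive \<iota> \<Delta> y \<longleftrightarrow> (\<exists>g h. grouplike \<iota> \<Delta> g \<and> grouplike \<iota> \<Delta> h \<and>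
      tens_eq \<iota> (\<Delta> y) [(g, y), (y, h)])"

text \<open>The points of G: characters (k-algebra maps) R -> k, a group under convolution.
  DeltaR r is a representative of Delta r with both legs in R.\<close>
definition DeltaR :: "('k::field \<Rightarrow> 'a::ring_1) \<Rightarrow> ('a \<Rightarrow> ('a \<times> 'a) list) \<Rightarrow> 'a set \<Rightarrow> 'a \<Rightarrow> ('a \<times> 'a) list" where
  "DeltaR \<iota> \<Delta> R r = (SOME ys. set ys \<subseteq> R \<times> R \<and> tens_eq \<iota> (\<Delta> r) ys)"

definition character :: "('k::field \<Rightarrow> 'a::ring_1) \<Rightarrow> 'a set \<Rightarrow> ('a \<Rightarrow> 'k) \<Rightarrow> bool" where
  "character \<iota> R \<chi> \<longleftrightarrow> (\<forall>r\<in>R. \<forall>s\<in>R. \<chi> (r + s) = \<chi> r + \<chi> s \<and> \<chi> (r * s) = \<chi> r * \<chi> s)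
     \<and> (\<forall>c. \<chi> (\<iota> c) = c)"

definition convol :: "('k::field \<Rightarrow> 'a::ring_1) \<Rightarrow> ('a \<Rightarrow> ('a \<times> 'a) list) \<Rightarrow> 'a set
    \<Rightarrow> ('a \<Rightarrow> 'k) \<Rightarrow> ('a \<Rightarrow> 'k) \<Rightarrow> 'a \<Rightarrow> 'k" where
  "convol \<iota> \<Delta> R \<chi> \<psi> r = (\<Sum>(u, v)\<leftarrow>DeltaR \<iota> \<Delta> R r. \<chi> u * \<psi> v)"

definition central_point :: "('k::field \<Rightarrow> 'a::ring_1) \<Rightarrow> ('a \<Rightarrow> ('a \<times> 'a) list) \<Rightarrow> 'a set
    \<Rightarrow> ('a \<Rightarrow> 'k) \<Rightarrow> bool" where
  "central_point \<iota> \<Delta> R \<chi> \<longleftrightarrow> character \<iota> R \<chi> \<and>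
     (\<forall>\<psi>. character \<iota> R \<psi> \<longrightarrow> (\<forall>r\<in>R. convol \<iota> \<Delta> R \<chi> \<psi> r = convol \<iota> \<Delta> R \<psi> \<chi> r))"

definition winding_l :: "('k::field \<Rightarrow> 'a::ring_1) \<Rightarrow> ('a \<Rightarrow> ('a \<times> 'a) list) \<Rightarrow> 'a set
    \<Rightarrow> ('a \<Rightarrow> 'k) \<Rightarrow> 'a \<Rightarrow> 'a" where
  "winding_l \<iota> \<Delta> R \<chi> f = (\<Sum>(u, v)\<leftarrow>DeltaR \<iota> \<Delta> R f. \<iota> (\<chi> u) * v)"

definition winding_r :: "('k::field \<Rightarrow> 'a::ring_1) \<Rightarrow> ('a \<Rightarrow> ('a \<times> 'a) list) \<Rightarrow> 'a set
    \<Rightarrow> ('a \<Rightarrow> 'k) \<Rightarrow> 'a \<Rightarrow> 'a" where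
  "winding_r \<iota> \<Delta> R \<chi> f = (\<Sum>(u, v)\<leftarrow>DeltaR \<iota> \<Delta> R f. u * \<iota> (\<chi> v))"

end

theory Submission
  imports Defs
begin

text \<open>
  Comparing degrees in the antipode identity for \<open>x\<close> gives \<open>\<Sum> S(v\<^sub>1) v\<^sub>2 = 0\<close>. The coefficient of
  \<open>1 \<otimes> x \<otimes> x\<close> in coassociativity then forces \<open>v = 0\<close>, because \<open>a \<noteq> 0\<close>. Once
  \<open>\<Delta>(x) = a \<otimes> x + x \<otimes> b + w\<close>, coassociativity makes \<open>a\<close> and \<open>b\<close> group-like, and applying \<open>\<Delta>\<close> to
  \<open>x r = \<sigma>(r) x + \<delta>(r)\<close> yields \<open>\<sigma>(r) = \<Sum> r\<^sub>1 \<chi>(r\<^sub>2) = \<Sum> \<chi>(r\<^sub>1) r\<^sub>2\<close> for \<open>\<chi> = \<epsilon> \<circ> \<sigma>\<close>, so \<open>\<chi>\<close> is a central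
  point of \<open>G\<close>. Variance at the kernel of \<open>\<epsilon>\<close> says that \<open>\<chi> \<noteq> \<epsilon>\<close>; since
  \<open>\<Sum> S(r\<^sub>1) (r\<^sub>2 - \<sigma>(r\<^sub>2)) = \<epsilon>(r) - \<chi>(r)\<close>, the elements \<open>r - \<sigma>(r)\<close> generate the unit ideal of \<open>R\<close>.
  As \<open>(s - \<sigma>(s)) \<delta>(r) = (r - \<sigma>(r)) \<delta>(s)\<close>, the derivation is then inner, \<open>\<delta>(r) = c (r - \<sigma>(r))\<close>. For
  \<open>x - c\<close> the remaining tensor \<open>w\<close> satisfies \<open>w \<Delta>(r - \<sigma>(r)) = 0\<close>, hence vanishes.
\<close>

section \<open>Sums over tensors\<close>

text \<open>The value of a map on the tensor represented by a list. With \<open>B\<close> arbitrary,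
  equalities of tensors become equalities of such sums, and Sweedler notation becomes nested
  \<open>tsum\<close>s.\<close>

definition tsum :: "('a \<times> 'b) list \<Rightarrow> ('a \<Rightarrow> 'b \<Rightarrow> 'c::ab_group_add) \<Rightarrow> 'c" where
  "tsum xs B = (\<Sum>(u, v)\<leftarrow>xs. B u v)"

lemma tsum_Nil [simp]: "tsum [] B = 0"
  and tsum_Cons [simp]: "tsum (p # xs) B = B (fst p) (snd p) + tsum xs B"
  and tsum_append [simp]: "tsum (xs @ ys) B = tsum xs B + tsum ys B"
  by (simp_all add: tsum_def case_prod_beta)

lemma tsum_map [simp]:
  "tsum (map (\<lambda>(u, v). (f u v, g u v)) xs) B = tsum xs (\<lambda>u v. B (f u v) (g u v))"
  by (induction xs) auto

lemma tsum_map_Pair [simp]: "tsum (map (Pair u) xs) B = tsum xs (\<lambda>p q. B u (p, q))"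
  by (induction xs) auto

lemma tsum_concat_map:
  "tsum (concat (map (\<lambda>(u, v). h u v) xs)) B = tsum xs (\<lambda>u v. tsum (h u v) B)"
  by (induction xs) auto

lemma tsum_cong:
  assumes "\<And>u v. (u, v) \<in> set xs \<Longrightarrow> B u v = C u v"
  shows "tsum xs B = tsum xs C"
  using assms by (induction xs) auto

lemma tsum_zero [simp]: "tsum xs (\<lambda>_ _. 0) = 0"
  by (induction xs) auto

lemma tsum_neutral: "(\<And>u v. (u, v) \<in> set xs \<Longrightarrow> B u v = 0) \<Longrightarrow> tsum xs B = 0"
  using tsum_cong[of xs B "\<lambda>_ _. 0"] by simp

lemma tsum_add: "tsum xs (\<lambda>u v. B u v + C u v) = tsum xs B + tsum xs C"
  by (induction xs) (auto simp: algebra_simps)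

lemma tsum_diff: "tsum xs (\<lambda>u v. B u v - C u v) = tsum xs B - tsum xs C"
  by (induction xs) (auto simp: algebra_simps)

lemma tsum_mult_left: "tsum xs (\<lambda>u v. c * B u v) = (c :: 'a::ring) * tsum xs B"
  by (induction xs) (auto simp: algebra_simps)

lemma tsum_mult_right: "tsum xs (\<lambda>u v. B u v * c) = tsum xs B * (c :: 'a::ring)"
  by (induction xs) (auto simp: algebra_simps)

lemma tsum_sum: "tsum xs (\<lambda>u v. \<Sum>e\<in>E. B e u v) = (\<Sum>e\<in>E. tsum xs (B e))"
  by (induction xs) (auto simp: sum.distrib)

lemma tsum_swap: "tsum xs (\<lambda>u v. tsum ys (B u v)) = tsum ys (\<lambda>p q. tsum xs (\<lambda>u v. B u v p q))"
  by (induction xs) (auto simp: tsum_add)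

lemma tsum_additive:
  assumes "\<And>a b. f (a + b) = f a + f b" "f 0 = 0"
  shows "f (tsum xs B) = tsum xs (\<lambda>u v. f (B u v))"
  by (induction xs) (auto simp: assms)

lemma tsum_closed:
  assumes "\<And>a b. a \<in> R \<Longrightarrow> b \<in> R \<Longrightarrow> a + b \<in> R" "0 \<in> R"
    and "\<And>u v. (u, v) \<in> set xs \<Longrightarrow> B u v \<in> R"
  shows "tsum xs B \<in> R"
  using assms(3) by (induction xs) (auto simp: assms(1,2))

text \<open>Serves maps that are additive only on \<open>R\<close>, such as the characters of
  \<open>R\<close>, whose values outside \<open>R\<close> are arbitrary.\<close>

lemma tsum_additive_on:
  assumes "\<And>a b. a \<in> R \<Longrightarrow> b \<in> R \<Longrightarrow> f (a + b) = f a + f b" "f 0 = 0"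
    and "\<And>a b. a \<in> R \<Longrightarrow> b \<in> R \<Longrightarrow> a + b \<in> R" "0 \<in> R"
    and "\<And>u v. (u, v) \<in> set xs \<Longrightarrow> B u v \<in> R"
  shows "f (tsum xs B) = tsum xs (\<lambda>u v. f (B u v))"
  using assms(5)
proof (induction xs)
  case (Cons p xs)
  have "tsum xs B \<in> R" using Cons.prems by (intro tsum_closed) (auto simp: assms)
  then show ?case using Cons assms(1) by (cases p) auto
qed (simp add: assms(2))

section \<open>Multilinear maps on tensors\<close>

text \<open>Values are taken in the algebra itself rather than in \<open>k\<close>, so that
  multiplication, the antipode and coefficient maps can be inserted directly. Scalar-valued forms
  are recovered through \<open>\<iota>\<close>.\<close>

definition bilin :: "('k::field \<Rightarrow> 'a::ring_1) \<Rightarrow> ('a \<Rightarrow> 'a \<Rightarrow> 'a) \<Rightarrow> bool" where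
  "bilin \<iota> B \<longleftrightarrow> (\<forall>v. klin_end \<iota> (\<lambda>u. B u v)) \<and> (\<forall>u. klin_end \<iota> (\<lambda>v. B u v))"

definition trilin :: "('k::field \<Rightarrow> 'a::ring_1) \<Rightarrow> ('a \<Rightarrow> 'a \<Rightarrow> 'a \<Rightarrow> 'a) \<Rightarrow> bool" where
  "trilin \<iota> F \<longleftrightarrow> (\<forall>v w. klin_end \<iota> (\<lambda>u. F u v w)) \<and> (\<forall>u w. klin_end \<iota> (\<lambda>v. F u v w))
     \<and> (\<forall>u v. klin_end \<iota> (\<lambda>w. F u v w))"

lemma bilinI:
  "(\<And>v. klin_end \<iota> (\<lambda>u. B u v)) \<Longrightarrow> (\<And>u. klin_end \<iota> (\<lambda>v. B u v)) \<Longrightarrow> bilin \<iota> B"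
  by (simp add: bilin_def)

lemma trilinI:
  "(\<And>v w. klin_end \<iota> (\<lambda>u. F u v w)) \<Longrightarrow> (\<And>u w. klin_end \<iota> (\<lambda>v. F u v w))
     \<Longrightarrow> (\<And>u v. klin_end \<iota> (\<lambda>w. F u v w)) \<Longrightarrow> trilin \<iota> F"
  by (simp add: trilin_def)

lemma klin_end_add: "klin_end \<iota> f \<Longrightarrow> f (a + b) = f a + f b"
  and klin_end_scale: "klin_end \<iota> f \<Longrightarrow> f (\<iota> c * a) = \<iota> c * f a"
  by (auto simp: klin_end_def)

lemma klin_end_0: "klin_end \<iota> f \<Longrightarrow> f 0 = 0"
  using klin_end_add[of \<iota> f 0 0] by simp

lemma klin_end_sum: "klin_end \<iota> f \<Longrightarrow> f (sum g E) = (\<Sum>e\<in>E. f (g e))"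
  by (induction E rule: infinite_finite_induct) (auto simp: klin_end_add klin_end_0)

lemma klin_end_tsum: "klin_end \<iota> f \<Longrightarrow> f (tsum xs B) = tsum xs (\<lambda>u v. f (B u v))"
  by (rule tsum_additive) (auto simp: klin_end_add klin_end_0)

lemma kalg_add: "kalg \<iota> \<Longrightarrow> \<iota> (c + d) = \<iota> c + \<iota> d"
  and kalg_mult: "kalg \<iota> \<Longrightarrow> \<iota> (c * d) = \<iota> c * \<iota> d"
  and kalg_1: "kalg \<iota> \<Longrightarrow> \<iota> 1 = 1"
  and kalg_commute: "kalg \<iota> \<Longrightarrow> \<iota> c * a = a * \<iota> c"
  unfolding kalg_def by blast+

lemma kalg_0: "kalg \<iota> \<Longrightarrow> \<iota> 0 = 0"
  using kalg_add[of \<iota> 0 0] by simp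

text \<open>Coordinates with respect to a vector space basis of the algebra. Allowing any finite
  \<open>E\<close> above the support lets all legs of several tensors be expanded over one common
  index set.\<close>

lemma kalg_dual_basis:
  fixes \<iota> :: "'k::field \<Rightarrow> 'a::ring_1"
  assumes "kalg \<iota>"
  shows "\<exists>(\<phi> :: 'a \<Rightarrow> 'a \<Rightarrow> 'k) supp. (\<forall>e. klin_fun \<iota> (\<phi> e)) \<and> (\<forall>a. finite (supp a)) \<and>
    (\<forall>a E. finite E \<longrightarrow> supp a \<subseteq> E \<longrightarrow> a = (\<Sum>e\<in>E. \<iota> (\<phi> e a) * e))"
proof -
  interpret V: vector_space "\<lambda>c a. \<iota> c * a"
    by unfold_locales
      (simp_all add: kalg_add[OF assms] kalg_mult[OF assms] kalg_1[OF assms] algebra_simps)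
  define Bs where "Bs = V.extend_basis {}"
  have ind: "V.independent Bs" and span: "V.span Bs = UNIV"
    unfolding Bs_def by (auto simp: V.independent_extend_basis V.span_extend_basis V.independent_empty)
  show ?thesis
  proof (intro exI conjI allI impI)
    show "klin_fun \<iota> (\<lambda>a. V.representation Bs a e)" for e
      unfolding klin_fun_def using ind span
      by (auto simp: V.representation_add V.representation_scale)
    show "finite {e. V.representation Bs a e \<noteq> 0}" for a
      by (rule V.finite_representation)
    show "a = (\<Sum>e\<in>E. \<iota> (V.representation Bs a e) * e)"
      if "finite E" "{e. V.representation Bs a e \<noteq> 0} \<subseteq> E" for a E
    proof -
      have "a = (\<Sum>e | V.representation Bs a e \<noteq> 0. \<iota> (V.representation Bs a e) * e)"
        using V.sum_nonzero_representation_eq[OF ind, of a] span by simp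
      also have "\<dots> = (\<Sum>e\<in>E. \<iota> (V.representation Bs a e) * e)"
        using that by (intro sum.mono_neutral_left) auto
      finally show ?thesis .
    qed
  qed
qed

lemma klin_fun_separate:
  assumes "kalg \<iota>" "\<And>f. klin_fun \<iota> f \<Longrightarrow> f a = f b"
  shows "a = b"
proof -
  obtain \<phi> supp where *: "\<And>e. klin_fun \<iota> (\<phi> e)" "\<And>a. finite (supp a)"
    "\<And>a E. finite E \<Longrightarrow> supp a \<subseteq> E \<Longrightarrow> a = (\<Sum>e\<in>E. \<iota> (\<phi> e a) * e)"
    using kalg_dual_basis[OF assms(1)] by blast
  let ?E = "supp a \<union> supp b"
  have "a = (\<Sum>e\<in>?E. \<iota> (\<phi> e a) * e)" by (rule *(3)) (auto simp: *)
  also have "\<dots> = (\<Sum>e\<in>?E. \<iota> (\<phi> e b) * e)" using assms(2)[OF *(1)] by simp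
  also have "\<dots> = b" by (rule *(3)[symmetric]) (auto simp: *)
  finally show ?thesis .
qed

lemma klin_fun_tsum:
  assumes "klin_fun \<iota> g"
  shows "g (tsum xs B) = tsum xs (\<lambda>u v. g (B u v))"
proof (rule tsum_additive)
  show add: "g (a + b) = g a + g b" for a b using assms by (simp add: klin_fun_def)
  show "g 0 = 0" using add[of 0 0] by (metis add_cancel_left_left add_0)
qed

lemma klin_fun_scale: "klin_fun \<iota> g \<Longrightarrow> g (\<iota> c * a) = c * g a"
  by (simp add: klin_fun_def)

text \<open>Expanding all left legs over a common finite part \<open>E\<close> of a basis turns the
  value of \<open>B\<close> into a sum of \<open>B e\<close> applied to the contraction by the
  coordinate functional of \<open>e\<close>. So the left contractions determine a tensor.\<close>

lemma tsum_eqI_left: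
  assumes k: "kalg \<iota>"
    and eq: "\<And>f. klin_fun \<iota> f \<Longrightarrow> tsum xs (\<lambda>u v. \<iota> (f u) * v) = tsum ys (\<lambda>u v. \<iota> (f u) * v)"
    and B: "bilin \<iota> B"
  shows "tsum xs B = tsum ys B"
proof -
  obtain \<phi> supp where *: "\<And>e. klin_fun \<iota> (\<phi> e)" "\<And>a. finite (supp a)"
    "\<And>a E. finite E \<Longrightarrow> supp a \<subseteq> E \<Longrightarrow> a = (\<Sum>e\<in>E. \<iota> (\<phi> e a) * e)"
    using kalg_dual_basis[OF k] by blast
  have B1: "klin_end \<iota> (\<lambda>u. B u v)" and B2: "klin_end \<iota> (\<lambda>v. B u v)" for u v
    using B by (auto simp: bilin_def)
  define E where "E = (\<Union>u\<in>fst ` set (xs @ ys). supp u)"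
  have "finite E" unfolding E_def using *(2) by auto
  have expand: "tsum zs B = (\<Sum>e\<in>E. B e (tsum zs (\<lambda>u v. \<iota> (\<phi> e u) * v)))"
    if "set zs \<subseteq> set (xs @ ys)" for zs
  proof -
    have "B u v = (\<Sum>e\<in>E. B e (\<iota> (\<phi> e u) * v))" if "(u, v) \<in> set zs" for u v
    proof -
      have "supp u \<subseteq> E"
        unfolding E_def using that \<open>set zs \<subseteq> _\<close> by force
      then have "u = (\<Sum>e\<in>E. \<iota> (\<phi> e u) * e)"
        by (rule *(3)[OF \<open>finite E\<close>])
      then have "B u v = B (\<Sum>e\<in>E. \<iota> (\<phi> e u) * e) v"
        by (rule arg_cong[where f = "\<lambda>u. B u v"])
      then show ?thesis
        by (simp add: klin_end_sum[OF B1] klin_end_scale[OF B1] klin_end_scale[OF B2])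
    qed
    then have "tsum zs B = tsum zs (\<lambda>u v. \<Sum>e\<in>E. B e (\<iota> (\<phi> e u) * v))"
      by (rule tsum_cong)
    then show ?thesis by (simp add: tsum_sum klin_end_tsum[OF B2])
  qed
  show ?thesis using eq[OF *(1)] by (simp add: expand)
qed

lemma bilin_flip: "bilin \<iota> B \<Longrightarrow> bilin \<iota> (\<lambda>v u. B u v)"
  by (auto simp: bilin_def)

lemma tsum_eqI_right:
  assumes k: "kalg \<iota>"
    and eq: "\<And>f. klin_fun \<iota> f \<Longrightarrow> tsum xs (\<lambda>u v. u * \<iota> (f v)) = tsum ys (\<lambda>u v. u * \<iota> (f v))"
    and B: "bilin \<iota> B"
  shows "tsum xs B = tsum ys B"
proof -
  let ?sw = "map (\<lambda>(u, v). (v, u))"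
  have "tsum (?sw xs) (\<lambda>v u. B u v) = tsum (?sw ys) (\<lambda>v u. B u v)"
    using eq by (intro tsum_eqI_left[OF k _ bilin_flip[OF B]]) (simp add: kalg_commute[OF k])
  then show ?thesis by simp
qed

text \<open>Contracting the left leg by \<open>f\<close> leaves an algebra element, and functionals
  \<open>g\<close> on the right leg separate such elements. This carries the functional definition
  of tensor equality over to arbitrary bilinear maps.\<close>

lemma tens_eq_tsum:
  assumes k: "kalg \<iota>" and eq: "tens_eq \<iota> xs ys" and B: "bilin \<iota> B"
  shows "tsum xs B = tsum ys B"
proof (rule tsum_eqI_left[OF k _ B], rule klin_fun_separate[OF k])
  fix f g assume "klin_fun \<iota> f" "klin_fun \<iota> g"
  then show "g (tsum xs (\<lambda>u v. \<iota> (f u) * v)) = g (tsum ys (\<lambda>u v. \<iota> (f u) * v))"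
    using eq by (simp add: klin_fun_tsum klin_fun_scale tens_eq_def flip: tsum_def)
qed

lemma bilin_mult_klin_fun:
  assumes k: "kalg \<iota>" and fg: "klin_fun \<iota> f" "klin_fun \<iota> g"
  shows "bilin \<iota> (\<lambda>u v. \<iota> (f u * g v))"
proof -
  have *: "f (a + b) = f a + f b" "g (a + b) = g a + g b" for a b
    using fg by (auto simp: klin_fun_def)
  show ?thesis
    by (simp add: bilin_def klin_end_def * klin_fun_scale[OF fg(1)] klin_fun_scale[OF fg(2)]
        distrib_left distrib_right kalg_add[OF k] ac_simps flip: kalg_mult[OF k])
qed

lemma kalg_inj:
  assumes "kalg \<iota>" "\<iota> c = \<iota> d"
  shows "c = d"
proof (rule ccontr)
  assume "c \<noteq> d"
  have "\<iota> c = \<iota> (c - d) + \<iota> d" using kalg_add[OF assms(1), of "c - d" d] by simp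
  then have "\<iota> (c - d) = 0" using assms(2) by simp
  moreover have "\<iota> (c - d) * \<iota> (inverse (c - d)) = 1"
    using \<open>c \<noteq> d\<close> by (simp add: kalg_1[OF assms(1)] flip: kalg_mult[OF assms(1)])
  ultimately show False by simp
qed

text \<open>The product of two functionals, composed with the injective map \<open>\<iota>\<close>,
  is itself an admissible \<open>B\<close>.\<close>

lemma tens_eqI:
  assumes k: "kalg \<iota>" and eq: "\<And>B. bilin \<iota> B \<Longrightarrow> tsum xs B = tsum ys B"
  shows "tens_eq \<iota> xs ys"
  unfolding tens_eq_def tsum_def[symmetric]
proof (intro allI impI, elim conjE)
  fix f g assume fg: "klin_fun \<iota> f" "klin_fun \<iota> g"
  have "\<iota> (tsum zs (\<lambda>u v. f u * g v)) = tsum zs (\<lambda>u v. \<iota> (f u * g v))" for zs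
    by (rule tsum_additive) (simp_all add: kalg_add[OF k] kalg_0[OF k])
  then have "\<iota> (tsum xs (\<lambda>u v. f u * g v)) = \<iota> (tsum ys (\<lambda>u v. f u * g v))"
    using eq[OF bilin_mult_klin_fun[OF k fg]] by simp
  then show "tsum xs (\<lambda>u v. f u * g v) = tsum ys (\<lambda>u v. f u * g v)"
    by (rule kalg_inj[OF k])
qed

text \<open>Contracting the first leg by a coordinate functional and absorbing the scalar into the
  second leg reduces triple tensors to the case of two legs.\<close>

lemma tens3_eq_tsum:
  assumes k: "kalg \<iota>" and eq: "tens3_eq \<iota> xs ys" and F: "trilin \<iota> F"
  shows "tsum xs (\<lambda>u (v, w). F u v w) = tsum ys (\<lambda>u (v, w). F u v w)"
proof -
  obtain \<phi> supp where *: "\<And>e. klin_fun \<iota> (\<phi> e)" "\<And>a. finite (supp a)"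
    "\<And>a E. finite E \<Longrightarrow> supp a \<subseteq> E \<Longrightarrow> a = (\<Sum>e\<in>E. \<iota> (\<phi> e a) * e)"
    using kalg_dual_basis[OF k] by blast
  have F1: "klin_end \<iota> (\<lambda>u. F u v w)" and F2: "klin_end \<iota> (\<lambda>v. F u v w)"
    and F3: "klin_end \<iota> (\<lambda>w. F u v w)" for u v w
    using F by (auto simp: trilin_def)
  define E where "E = (\<Union>u\<in>fst ` set (xs @ ys). supp u)"
  have "finite E" unfolding E_def using *(2) by auto
  let ?red = "\<lambda>e zs. map (\<lambda>(u, p). (\<iota> (\<phi> e u) * fst p, snd p)) zs"
  have expand: "tsum zs (\<lambda>u (v, w). F u v w) = (\<Sum>e\<in>E. tsum (?red e zs) (F e))"
    if "set zs \<subseteq> set (xs @ ys)" for zs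
  proof -
    have "(case p of (v, w) \<Rightarrow> F u v w) = (\<Sum>e\<in>E. F e (\<iota> (\<phi> e u) * fst p) (snd p))"
      if "(u, p) \<in> set zs" for u p
    proof -
      have "supp u \<subseteq> E"
        unfolding E_def using that \<open>set zs \<subseteq> _\<close> by force
      then have "u = (\<Sum>e\<in>E. \<iota> (\<phi> e u) * e)"
        by (rule *(3)[OF \<open>finite E\<close>])
      then have "F u (fst p) (snd p) = F (\<Sum>e\<in>E. \<iota> (\<phi> e u) * e) (fst p) (snd p)"
        by (rule arg_cong[where f = "\<lambda>u. F u (fst p) (snd p)"])
      then show ?thesis
        by (simp add: klin_end_sum[OF F1] klin_end_scale[OF F1] klin_end_scale[OF F2] case_prod_beta)
    qed
    then have "tsum zs (\<lambda>u (v, w). F u v w)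
        = tsum zs (\<lambda>u p. \<Sum>e\<in>E. F e (\<iota> (\<phi> e u) * fst p) (snd p))"
      by (rule tsum_cong)
    then show ?thesis by (simp add: tsum_sum)
  qed
  have "tsum (?red e xs) (F e) = tsum (?red e ys) (F e)" for e
  proof (rule tens_eq_tsum[OF k])
    show "bilin \<iota> (F e)" using F2 F3 by (intro bilinI) auto
    show "tens_eq \<iota> (?red e xs) (?red e ys)"
      unfolding tens_eq_def tsum_def[symmetric]
    proof (intro allI impI, elim conjE)
      fix f g assume fg: "klin_fun \<iota> f" "klin_fun \<iota> g"
      have "tsum (?red e zs) (\<lambda>u v. f u * g v) = (\<Sum>(u, v, w)\<leftarrow>zs. \<phi> e u * f v * g w)" for zs
        by (simp add: klin_fun_scale[OF fg(1)]) (simp add: tsum_def case_prod_unfold)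
      then show "tsum (?red e xs) (\<lambda>u v. f u * g v) = tsum (?red e ys) (\<lambda>u v. f u * g v)"
        using eq fg *(1) by (simp add: tens3_eq_def)
    qed
  qed
  then show ?thesis by (simp add: expand)
qed


section \<open>Hopf algebras with a commutative Hopf subalgebra\<close>

locale comm_hopf_sub =
  fixes \<iota> :: "'k::field \<Rightarrow> 'a::ring_1" and \<Delta> :: "'a \<Rightarrow> ('a \<times> 'a) list"
    and \<epsilon> :: "'a \<Rightarrow> 'k" and S :: "'a \<Rightarrow> 'a" and R :: "'a set"
  assumes hopf: "hopf_alg \<iota> \<Delta> \<epsilon> S" and sub: "hopf_subalg \<iota> \<Delta> S R"
    and R_commute: "r \<in> R \<Longrightarrow> s \<in> R \<Longrightarrow> r * s = s * r"
    and R_domain: "r \<in> R \<Longrightarrow> s \<in> R \<Longrightarrow> r * s = 0 \<Longrightarrow> r = 0 \<or> s = 0"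
begin

abbreviation "lin \<equiv> klin_end \<iota>"

lemma k: "kalg \<iota>" using hopf by (simp add: hopf_alg_def)

lemmas \<iota>_simps = kalg_add[OF k] kalg_mult[OF k] kalg_1[OF k] kalg_0[OF k]

lemma \<iota>_assoc: "a * (\<iota> c * b) = \<iota> c * (a * b)"
  by (metis kalg_commute[OF k] mult.assoc)

lemma R_\<iota> [simp, intro]: "\<iota> c \<in> R"
  and R_add [simp, intro]: "r \<in> R \<Longrightarrow> s \<in> R \<Longrightarrow> r + s \<in> R"
  and R_mult [simp, intro]: "r \<in> R \<Longrightarrow> s \<in> R \<Longrightarrow> r * s \<in> R"
  and R_uminus [simp, intro]: "r \<in> R \<Longrightarrow> - r \<in> R"
  and R_S [simp, intro]: "r \<in> R \<Longrightarrow> S r \<in> R"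
  using sub by (auto simp: hopf_subalg_def ksubalg_def)

lemma R_0 [simp, intro]: "0 \<in> R" and R_1 [simp, intro]: "1 \<in> R"
  using R_\<iota>[of 0] R_\<iota>[of 1] by (simp_all add: \<iota>_simps)

lemma R_diff [simp, intro]: "r \<in> R \<Longrightarrow> s \<in> R \<Longrightarrow> r - s \<in> R"
  using R_add[of r "- s"] by simp

lemma R_tsum [intro]: "(\<And>u v. (u, v) \<in> set xs \<Longrightarrow> B u v \<in> R) \<Longrightarrow> tsum xs B \<in> R"
  by (rule tsum_closed) auto

lemma S_lin: "lin S" and \<epsilon>_add: "\<epsilon> (a + b) = \<epsilon> a + \<epsilon> b" and \<epsilon>_mult: "\<epsilon> (a * b) = \<epsilon> a * \<epsilon> b"
  and \<epsilon>_\<iota>: "\<epsilon> (\<iota> c) = c" and S_inj: "inj S"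
  using hopf by (auto simp: hopf_alg_def bij_def)

lemma \<epsilon>_0: "\<epsilon> 0 = 0" and \<epsilon>_1: "\<epsilon> 1 = 1"
  using \<epsilon>_\<iota>[of 0] \<epsilon>_\<iota>[of 1] by (simp_all add: \<iota>_simps)

lemma \<epsilon>_lin: "klin_fun \<iota> \<epsilon>"
  by (simp add: klin_fun_def \<epsilon>_add \<epsilon>_mult \<epsilon>_\<iota>)

lemma \<epsilon>_tsum: "\<epsilon> (tsum xs B) = tsum xs (\<lambda>u v. \<epsilon> (B u v))"
  by (rule klin_fun_tsum[OF \<epsilon>_lin])

lemma \<iota>_tsum: "\<iota> (tsum xs B) = tsum xs (\<lambda>u v. \<iota> (B u v))"
  by (rule tsum_additive) (simp_all add: \<iota>_simps)

text \<open>The given comultiplication picks arbitrary representatives; on \<open>R\<close> this one has both legs in \<open>R\<close>.\<close>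

definition D :: "'a \<Rightarrow> ('a \<times> 'a) list" where
  "D a = (if a \<in> R then DeltaR \<iota> \<Delta> R a else \<Delta> a)"

lemma DeltaR_props:
  assumes "r \<in> R"
  shows "set (DeltaR \<iota> \<Delta> R r) \<subseteq> R \<times> R \<and> tens_eq \<iota> (\<Delta> r) (DeltaR \<iota> \<Delta> R r)"
  unfolding DeltaR_def
  by (rule someI_ex) (use assms sub in \<open>auto simp: hopf_subalg_def in_tensR_def\<close>)

lemma D_R:
  assumes "r \<in> R" "(u, v) \<in> set (D r)"
  shows "u \<in> R" "v \<in> R"
  using assms DeltaR_props[of r] by (auto simp: D_def)

lemma D_eq: "bilin \<iota> B \<Longrightarrow> tsum (\<Delta> a) B = tsum (D a) B"
  using DeltaR_props[of a] by (auto simp: D_def intro: tens_eq_tsum[OF k])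

section \<open>Linearity and Hopf identities in Sweedler components\<close>

lemma lin_id: "lin (\<lambda>u. u)"
  and lin_mult_left: "lin f \<Longrightarrow> lin (\<lambda>u. c * f u)"
  and lin_mult_right: "lin f \<Longrightarrow> lin (\<lambda>u. f u * c)"
  and lin_S: "lin f \<Longrightarrow> lin (\<lambda>u. S (f u))"
  and lin_fun: "klin_fun \<iota> \<phi> \<Longrightarrow> lin f \<Longrightarrow> lin (\<lambda>u. \<iota> (\<phi> (f u)))"
  using S_lin by (simp_all add: klin_end_def klin_fun_def algebra_simps \<iota>_assoc \<iota>_simps)

lemma lin_\<epsilon>: "lin f \<Longrightarrow> lin (\<lambda>u. \<iota> (\<epsilon> (f u)))"
  by (rule lin_fun[OF \<epsilon>_lin])

lemma lin_tsum:
  assumes "\<And>p q. lin (\<lambda>u. F u p q)"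
  shows "lin (\<lambda>u. tsum xs (\<lambda>p q. F u p q))"
proof -
  have "tsum xs (F (a + b)) = tsum xs (\<lambda>p q. F a p q + F b p q)"
    "tsum xs (F (\<iota> c * a)) = tsum xs (\<lambda>p q. \<iota> c * F a p q)" for a b c
    by (intro tsum_cong klin_end_add[OF assms] klin_end_scale[OF assms])+
  then show ?thesis by (simp add: klin_end_def tsum_add tsum_mult_left)
qed

lemma D_add: "bilin \<iota> B \<Longrightarrow> tsum (D (a + b)) B = tsum (D a) B + tsum (D b) B"
proof -
  have "tens_eq \<iota> (\<Delta> (a + b)) (\<Delta> a @ \<Delta> b)" using hopf by (simp add: hopf_alg_def)
  then show "bilin \<iota> B \<Longrightarrow> ?thesis" using tens_eq_tsum[OF k] by (fastforce simp flip: D_eq)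
qed

lemma D_scale: "bilin \<iota> B \<Longrightarrow> tsum (D (\<iota> c * a)) B = \<iota> c * tsum (D a) B"
proof -
  assume B: "bilin \<iota> B"
  have "tens_eq \<iota> (\<Delta> (\<iota> c * a)) (map (\<lambda>(u, v). (\<iota> c * u, v)) (\<Delta> a))"
    using hopf by (simp add: hopf_alg_def)
  then have "tsum (\<Delta> (\<iota> c * a)) B = tsum (\<Delta> a) (\<lambda>u v. B (\<iota> c * u) v)"
    using tens_eq_tsum[OF k _ B] by fastforce
  also have "\<dots> = \<iota> c * tsum (\<Delta> a) B"
    using B by (simp add: bilin_def klin_end_def tsum_mult_left)
  finally show ?thesis using B by (simp flip: D_eq)
qed

lemma lin_D: "bilin \<iota> (\<lambda>p q. B p q) \<Longrightarrow> lin f \<Longrightarrow> lin (\<lambda>u. tsum (D (f u)) (\<lambda>p q. B p q))"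
  by (simp add: klin_end_def D_add D_scale)

lemmas lin_intros = lin_id lin_mult_left lin_mult_right lin_S lin_\<epsilon> lin_tsum lin_D bilinI trilinI

lemma D_mult:
  assumes B: "bilin \<iota> B"
  shows "tsum (D (a * b)) B = tsum (D a) (\<lambda>u v. tsum (D b) (\<lambda>p q. B (u * p) (v * q)))"
proof -
  have B1: "lin f \<Longrightarrow> lin (\<lambda>u. B (f u) v)" and B2: "lin f \<Longrightarrow> lin (\<lambda>v. B u (f v))" for u v f
    using B by (auto simp: bilin_def klin_end_def)
  have "tens_eq \<iota> (\<Delta> (a * b)) (tens_mult (\<Delta> a) (\<Delta> b))" using hopf by (simp add: hopf_alg_def)
  then have "tsum (\<Delta> (a * b)) B = tsum (\<Delta> a) (\<lambda>u v. tsum (\<Delta> b) (\<lambda>p q. B (u * p) (v * q)))"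
    using tens_eq_tsum[OF k _ B] by (fastforce simp: tens_mult_def tsum_concat_map)
  also have "\<dots> = tsum (\<Delta> a) (\<lambda>u v. tsum (D b) (\<lambda>p q. B (u * p) (v * q)))"
    by (intro tsum_cong D_eq lin_intros B1 B2)
  also have "\<dots> = tsum (D a) (\<lambda>u v. tsum (D b) (\<lambda>p q. B (u * p) (v * q)))"
    by (intro D_eq lin_intros B1 B2)
  finally show ?thesis using B by (simp add: D_eq)
qed

lemma D_one: "bilin \<iota> B \<Longrightarrow> tsum (D 1) B = B 1 1"
  using tens_eq_tsum[OF k, of "\<Delta> 1" "[(1, 1)]" B] hopf by (simp add: hopf_alg_def D_eq)

text \<open>Coassociativity for the representatives \<open>D\<close>. Inner and outer copies of
  \<open>\<Delta>\<close> can be exchanged for \<open>D\<close> one at a time because each nested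
  sum is bilinear in the remaining legs.\<close>

lemma D_coassoc:
  assumes F: "trilin \<iota> F"
  shows "tsum (D a) (\<lambda>u v. tsum (D u) (\<lambda>p q. F p q v)) = tsum (D a) (\<lambda>u v. tsum (D v) (\<lambda>p q. F u p q))"
proof -
  have F1: "lin f \<Longrightarrow> lin (\<lambda>u. F (f u) v w)" and F2: "lin f \<Longrightarrow> lin (\<lambda>v. F u (f v) w)"
    and F3: "lin f \<Longrightarrow> lin (\<lambda>w. F u v (f w))" for u v w f
    using F by (auto simp: trilin_def klin_end_def)
  have "tens3_eq \<iota> [(u1, u2, v). (u, v) \<leftarrow> \<Delta> a, (u1, u2) \<leftarrow> \<Delta> u] [(u, v1, v2). (u, v) \<leftarrow> \<Delta> a, (v1, v2) \<leftarrow> \<Delta> v]"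
    using hopf by (simp add: hopf_alg_def)
  from tens3_eq_tsum[OF k this F]
  have "tsum (\<Delta> a) (\<lambda>u v. tsum (\<Delta> u) (\<lambda>p q. F p q v)) = tsum (\<Delta> a) (\<lambda>u v. tsum (\<Delta> v) (\<lambda>p q. F u p q))"
    by (simp add: tsum_concat_map)
  moreover have "tsum (\<Delta> a) (\<lambda>u v. tsum (\<Delta> u) (\<lambda>p q. F p q v)) = tsum (\<Delta> a) (\<lambda>u v. tsum (D u) (\<lambda>p q. F p q v))"
    by (intro tsum_cong D_eq lin_intros F1 F2 F3)
  moreover have "\<dots> = tsum (D a) (\<lambda>u v. tsum (D u) (\<lambda>p q. F p q v))"
    by (intro D_eq lin_intros F1 F2 F3)
  moreover have "tsum (\<Delta> a) (\<lambda>u v. tsum (\<Delta> v) (\<lambda>p q. F u p q)) = tsum (\<Delta> a) (\<lambda>u v. tsum (D v) (\<lambda>p q. F u p q))"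
    by (intro tsum_cong D_eq lin_intros F1 F2 F3)
  moreover have "\<dots> = tsum (D a) (\<lambda>u v. tsum (D v) (\<lambda>p q. F u p q))"
    by (intro D_eq lin_intros F1 F2 F3)
  ultimately show ?thesis by simp
qed

lemma counit_left: "tsum (D a) (\<lambda>u v. \<iota> (\<epsilon> u) * v) = a"
  and counit_right: "tsum (D a) (\<lambda>u v. u * \<iota> (\<epsilon> v)) = a"
  and antipode_left: "tsum (D a) (\<lambda>u v. S u * v) = \<iota> (\<epsilon> a)"
  and antipode_right: "tsum (D a) (\<lambda>u v. u * S v) = \<iota> (\<epsilon> a)"
proof -
  have *: "tsum (\<Delta> a) (\<lambda>u v. \<iota> (\<epsilon> u) * v) = a" "tsum (\<Delta> a) (\<lambda>u v. u * \<iota> (\<epsilon> v)) = a"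
    "tsum (\<Delta> a) (\<lambda>u v. S u * v) = \<iota> (\<epsilon> a)" "tsum (\<Delta> a) (\<lambda>u v. u * S v) = \<iota> (\<epsilon> a)"
    using hopf by (simp_all add: hopf_alg_def tsum_def)
  show "tsum (D a) (\<lambda>u v. \<iota> (\<epsilon> u) * v) = a" "tsum (D a) (\<lambda>u v. u * \<iota> (\<epsilon> v)) = a"
    "tsum (D a) (\<lambda>u v. S u * v) = \<iota> (\<epsilon> a)" "tsum (D a) (\<lambda>u v. u * S v) = \<iota> (\<epsilon> a)"
    by (subst D_eq[symmetric], intro lin_intros, rule *)+
qed

section \<open>Multiplicativity properties of the antipode and its square on
  \<open>R\<close>\<close>

lemma S_\<iota>_right: "S (a * \<iota> c) = S a * \<iota> c"
  by (simp add: klin_end_scale[OF S_lin] flip: kalg_commute[OF k, of c])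

lemma \<iota>_mult_split: "\<iota> c * y * (\<iota> d * z) = \<iota> (d * c) * (y * z)"
proof -
  have "\<iota> c * y * (\<iota> d * z) = \<iota> c * (\<iota> d * (y * z))" by (simp add: mult.assoc \<iota>_assoc[of y])
  then show ?thesis by (simp add: kalg_mult[OF k] mult.assoc mult.commute[of d c])
qed

text \<open>In the convolution algebra, the map sending a pair to \<open>S (a * b)\<close> is a left
  inverse of multiplication and the map sending it to \<open>S b * S a\<close> is a right inverse,
  so they agree. The proof evaluates their triple convolution in two ways.\<close>

lemma S_mult: "S (a * b) = S b * S a"
proof -
  \<comment> \<open>Here \<open>p\<close>, \<open>q\<close>, \<open>r\<close> stand for the three
    Sweedler components of \<open>a\<close>, and the primed letters for those of
    \<open>b\<close>.\<close>
  let ?F = "\<lambda>p p' q q' r r'. S (p * p') * (q * q') * (S r' * S r)"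
  have "S (a * b) = tsum (D a) (\<lambda>p u. tsum (D b) (\<lambda>p' u'. S ((p * \<iota> (\<epsilon> u)) * (p' * \<iota> (\<epsilon> u')))))"
    by (simp add: tsum_mult_left tsum_mult_right counit_right flip: klin_end_tsum[OF S_lin])
  also have "\<dots> = tsum (D a) (\<lambda>p u. tsum (D b) (\<lambda>p' u'. S (p * p') * \<iota> (\<epsilon> u) * \<iota> (\<epsilon> u')))"
  proof (intro tsum_cong)
    fix p u p' u'
    have "(p * \<iota> (\<epsilon> u)) * (p' * \<iota> (\<epsilon> u')) = p * p' * \<iota> (\<epsilon> u) * \<iota> (\<epsilon> u')"
      by (simp add: mult.assoc) (simp add: kalg_commute[OF k, of "\<epsilon> u" p'] flip: mult.assoc)
    then show "S ((p * \<iota> (\<epsilon> u)) * (p' * \<iota> (\<epsilon> u'))) = S (p * p') * \<iota> (\<epsilon> u) * \<iota> (\<epsilon> u')"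
      by (simp add: S_\<iota>_right)
  qed
  also have "\<dots> = tsum (D a) (\<lambda>p u. tsum (D b) (\<lambda>p' u'. tsum (D u) (\<lambda>q r. tsum (D u') (\<lambda>q' r'. ?F p p' q q' r r'))))"
  proof (intro tsum_cong)
    fix p u p' u'
    have "tsum (D u) (\<lambda>q r. tsum (D u') (\<lambda>q' r'. ?F p p' q q' r r'))
        = tsum (D u) (\<lambda>q r. S (p * p') * (q * tsum (D u') (\<lambda>q' r'. q' * S r') * S r))"
      by (simp add: tsum_mult_left mult.assoc flip: tsum_mult_right)
    also have "\<dots> = tsum (D u) (\<lambda>q r. S (p * p') * (\<iota> (\<epsilon> u') * (q * S r)))"
      by (simp add: antipode_right \<iota>_assoc mult.assoc)
    also have "\<dots> = S (p * p') * (\<iota> (\<epsilon> u') * \<iota> (\<epsilon> u))"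
      by (simp only: tsum_mult_left antipode_right)
    finally show "S (p * p') * \<iota> (\<epsilon> u) * \<iota> (\<epsilon> u')
        = tsum (D u) (\<lambda>q r. tsum (D u') (\<lambda>q' r'. ?F p p' q q' r r'))"
      by (simp add: mult.assoc mult.commute flip: kalg_mult[OF k])
  qed
  \<comment> \<open>Interchanging the independent sums over \<open>a\<close> and \<open>b\<close>
    brings each pair of nested comultiplications together, so that coassociativity can regroup the
    first two components of each factor.\<close>
  also have "\<dots> = tsum (D a) (\<lambda>p u. tsum (D u) (\<lambda>q r. tsum (D b) (\<lambda>p' u'. tsum (D u') (\<lambda>q' r'. ?F p p' q q' r r'))))"
    by (intro tsum_cong tsum_swap)
  also have "\<dots> = tsum (D a) (\<lambda>p u. tsum (D u) (\<lambda>q r. tsum (D b) (\<lambda>u' r'. tsum (D u') (\<lambda>p' q'. ?F p p' q q' r r'))))"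
    by (intro tsum_cong D_coassoc[symmetric] lin_intros)
  also have "\<dots> = tsum (D a) (\<lambda>u r. tsum (D u) (\<lambda>p q. tsum (D b) (\<lambda>u' r'. tsum (D u') (\<lambda>p' q'. ?F p p' q q' r r'))))"
    by (intro tsum_cong D_coassoc[symmetric] lin_intros)
  also have "\<dots> = tsum (D a) (\<lambda>u r. tsum (D b) (\<lambda>u' r'. tsum (D u) (\<lambda>p q. tsum (D u') (\<lambda>p' q'. ?F p p' q q' r r'))))"
    by (intro tsum_cong tsum_swap)
  also have "\<dots> = tsum (D a) (\<lambda>u r. tsum (D b) (\<lambda>u' r'. tsum (D (u * u')) (\<lambda>p q. S p * q) * (S r' * S r)))"
    by (intro tsum_cong, subst D_mult, intro lin_intros) (simp add: tsum_mult_right)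
  also have "\<dots> = tsum (D a) (\<lambda>u r. tsum (D b) (\<lambda>u' r'. S (\<iota> (\<epsilon> u') * r') * S (\<iota> (\<epsilon> u) * r)))"
    by (simp add: antipode_left klin_end_scale[OF S_lin] \<epsilon>_mult \<iota>_mult_split)
  also have "\<dots> = S b * S a"
    by (simp add: tsum_mult_left tsum_mult_right counit_left flip: klin_end_tsum[OF S_lin])
  finally show ?thesis .
qed

lemma S_1: "S 1 = 1"
proof -
  have "S 1 * 1 = \<iota> (\<epsilon> 1)" using antipode_left[of 1] D_one[of "\<lambda>u v. S u * v"]
    by (simp add: lin_intros)
  then show ?thesis by (simp add: \<epsilon>_1 \<iota>_simps)
qed

text \<open>Convolving \<open>S \<circ> S\<close> with \<open>S\<close> gives terms
  \<open>S (S p) * S q = S (q * S p)\<close>. Commutativity of \<open>R\<close> turns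
  \<open>q * S p\<close> into \<open>S p * q\<close>, and the antipode axiom collapses the sum.
  Hence \<open>S \<circ> S\<close> and the identity are both convolution inverse to \<open>S\<close>
  on \<open>R\<close>.\<close>

lemma S_S:
  assumes r: "r \<in> R"
  shows "S (S r) = r"
proof -
  have "S (S r) = tsum (D r) (\<lambda>u v. S (S (u * \<iota> (\<epsilon> v))))"
    by (simp add: counit_right flip: klin_end_tsum[OF S_lin])
  also have "\<dots> = tsum (D r) (\<lambda>u v. S (S u) * \<iota> (\<epsilon> v))"
    by (simp add: S_\<iota>_right)
  also have "\<dots> = tsum (D r) (\<lambda>u v. tsum (D v) (\<lambda>p q. S (S u) * (S p * q)))"
    by (simp add: tsum_mult_left antipode_left)
  also have "\<dots> = tsum (D r) (\<lambda>u v. tsum (D u) (\<lambda>p q. S (S p) * (S q * v)))"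
    by (intro D_coassoc[symmetric] lin_intros)
  also have "\<dots> = tsum (D r) (\<lambda>u v. tsum (D u) (\<lambda>p q. S (S p * q)) * v)"
  proof (rule tsum_cong)
    fix u v assume "(u, v) \<in> set (D r)"
    then have "u \<in> R" using D_R r by blast
    have "tsum (D u) (\<lambda>p q. S (S p) * (S q * v)) = tsum (D u) (\<lambda>p q. S (S p * q) * v)"
    proof (rule tsum_cong)
      fix p q assume "(p, q) \<in> set (D u)"
      then have "S p * q = q * S p" using D_R[OF \<open>u \<in> R\<close>] R_commute by blast
      then show "S (S p) * (S q * v) = S (S p * q) * v" by (simp add: S_mult mult.assoc)
    qed
    then show "tsum (D u) (\<lambda>p q. S (S p) * (S q * v)) = tsum (D u) (\<lambda>p q. S (S p * q)) * v"
      by (simp add: tsum_mult_right)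
  qed
  also have "\<dots> = tsum (D r) (\<lambda>u v. \<iota> (\<epsilon> u) * v)"
  proof (intro tsum_cong)
    fix u v
    have "S (\<iota> (\<epsilon> u)) = \<iota> (\<epsilon> u)" using klin_end_scale[OF S_lin, of "\<epsilon> u" 1] by (simp add: S_1)
    then show "tsum (D u) (\<lambda>p q. S (S p * q)) * v = \<iota> (\<epsilon> u) * v"
      by (simp add: antipode_left flip: klin_end_tsum[OF S_lin])
  qed
  also have "\<dots> = r" by (rule counit_left)
  finally show ?thesis .
qed

text \<open>The counit is multiplicative, so it can be applied to the antipode identity after
  \<open>\<epsilon> (S a)\<close> has been split by the counit axiom.\<close>

lemma \<epsilon>_S: "\<epsilon> (S a) = \<epsilon> a"
proof -
  have "\<epsilon> (S a) = tsum (D a) (\<lambda>u v. \<epsilon> (S (u * \<iota> (\<epsilon> v))))"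
    by (simp add: counit_right flip: klin_end_tsum[OF S_lin] \<epsilon>_tsum)
  also have "\<dots> = tsum (D a) (\<lambda>u v. \<epsilon> (S u * v))"
    by (simp add: S_\<iota>_right \<epsilon>_mult \<epsilon>_\<iota>)
  also have "\<dots> = \<epsilon> a" by (simp add: antipode_left \<epsilon>_\<iota> flip: \<epsilon>_tsum)
  finally show ?thesis .
qed

end


section \<open>Coefficients in an Ore extension\<close>

locale hopf_ore = comm_hopf_sub \<iota> \<Delta> \<epsilon> S R
  for \<iota> :: "'k::field \<Rightarrow> 'a::ring_1" and \<Delta> :: "'a \<Rightarrow> ('a \<times> 'a) list"
    and \<epsilon> :: "'a \<Rightarrow> 'k" and S :: "'a \<Rightarrow> 'a" and R :: "'a set" +
  fixes x :: 'a and \<sigma> \<delta> :: "'a \<Rightarrow> 'a"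
  assumes ore: "ore_ext \<iota> R x \<sigma> \<delta>"
begin

lemma \<sigma>_bij: "bij_betw \<sigma> R R" and \<sigma>_\<iota>: "\<sigma> (\<iota> c) = \<iota> c"
  and \<sigma>_add: "r \<in> R \<Longrightarrow> s \<in> R \<Longrightarrow> \<sigma> (r + s) = \<sigma> r + \<sigma> s"
  and \<sigma>_mult: "r \<in> R \<Longrightarrow> s \<in> R \<Longrightarrow> \<sigma> (r * s) = \<sigma> r * \<sigma> s"
  and \<delta>_R [simp, intro]: "r \<in> R \<Longrightarrow> \<delta> r \<in> R"
  and \<delta>_mult: "r \<in> R \<Longrightarrow> s \<in> R \<Longrightarrow> \<delta> (r * s) = \<sigma> r * \<delta> s + \<delta> r * s"
  using ore by (auto simp: ore_ext_def)

lemma x_mult: "r \<in> R \<Longrightarrow> x * r = \<sigma> r * x + \<delta> r"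
  using ore by (auto simp: ore_ext_def algebra_simps)

lemma ore_free: "\<forall>i<n. rs i \<in> R \<Longrightarrow> (\<Sum>i<n. rs i * x ^ i) = 0 \<Longrightarrow> i < n \<Longrightarrow> rs i = 0"
  and ore_spans: "\<exists>n rs. (\<forall>i<n. rs i \<in> R) \<and> t = (\<Sum>i<n. rs i * x ^ i)"
  using ore unfolding ore_ext_def by simp_all

lemma \<sigma>_R [simp, intro]: "r \<in> R \<Longrightarrow> \<sigma> r \<in> R"
  using \<sigma>_bij by (auto simp: bij_betw_def)

lemma \<sigma>_0: "\<sigma> 0 = 0"
  using \<sigma>_\<iota>[of 0] by (simp add: \<iota>_simps)

lemma \<sigma>_pow_R: "r \<in> R \<Longrightarrow> (\<sigma> ^^ n) r \<in> R"
  by (induction n) auto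

lemma \<sigma>_pow_eq_0: "r \<in> R \<Longrightarrow> (\<sigma> ^^ n) r = 0 \<Longrightarrow> r = 0"
proof (induction n)
  case (Suc n)
  then have "\<sigma> ((\<sigma> ^^ n) r) = \<sigma> 0" by (simp add: \<sigma>_0)
  then have "(\<sigma> ^^ n) r = 0"
    using \<sigma>_bij \<sigma>_pow_R[OF Suc.prems(1)] by (auto simp: bij_betw_def dest: inj_onD)
  then show ?case using Suc by blast
qed simp

text \<open>Coefficient families are total on the naturals with finite support. The length of the
  expansion is then not part of the data, and a representing family is unique as a function.\<close>

definition is_rep :: "(nat \<Rightarrow> 'a) \<Rightarrow> 'a \<Rightarrow> bool" where
  "is_rep f t \<longleftrightarrow> (\<forall>i. f i \<in> R) \<and> (\<exists>n. (\<forall>i\<ge>n. f i = 0) \<and> t = (\<Sum>i<n. f i * x ^ i))"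

lemma is_repI:
  "(\<And>i. f i \<in> R) \<Longrightarrow> (\<And>i. i \<ge> n \<Longrightarrow> f i = 0) \<Longrightarrow> t = (\<Sum>i<n. f i * x ^ i) \<Longrightarrow> is_rep f t"
  unfolding is_rep_def by blast

definition cf :: "nat \<Rightarrow> 'a \<Rightarrow> 'a" where
  "cf i t = (THE f. is_rep f t) i"

lemma sum_extend:
  "\<forall>i\<ge>n. f i = (0::'a) \<Longrightarrow> n \<le> m \<Longrightarrow> (\<Sum>i<m. f i * x ^ i) = (\<Sum>i<n. f i * x ^ i)"
  by (rule sum.mono_neutral_right) auto

lemma is_rep_cong:
  assumes "is_rep f s" "is_rep g t"
  obtains n where "\<forall>i\<ge>n. f i = 0" "\<forall>i\<ge>n. g i = 0"
    "s = (\<Sum>i<n. f i * x ^ i)" "t = (\<Sum>i<n. g i * x ^ i)"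
proof -
  obtain n m where nm: "\<forall>i\<ge>n. f i = 0" "s = (\<Sum>i<n. f i * x ^ i)"
    "\<forall>i\<ge>m. g i = 0" "t = (\<Sum>i<m. g i * x ^ i)"
    using assms unfolding is_rep_def by blast
  have "s = (\<Sum>i<max n m. f i * x ^ i)"
    using nm(2) by (rule trans) (rule sum_extend[OF nm(1) max.cobounded1, symmetric])
  moreover have "t = (\<Sum>i<max n m. g i * x ^ i)"
    using nm(4) by (rule trans) (rule sum_extend[OF nm(3) max.cobounded2, symmetric])
  moreover have "\<forall>i\<ge>max n m. f i = 0" "\<forall>i\<ge>max n m. g i = 0" using nm(1,3) by auto
  ultimately show thesis by (intro that)
qed

lemma is_rep_unique:
  assumes f: "is_rep f t" and g: "is_rep g t"
  shows "f = g"
proof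
  fix i
  obtain n where n: "\<forall>i\<ge>n. f i = 0" "\<forall>i\<ge>n. g i = 0"
    "t = (\<Sum>i<n. f i * x ^ i)" "t = (\<Sum>i<n. g i * x ^ i)"
    using f g by (rule is_rep_cong)
  have "(\<Sum>i<n. (f i - g i) * x ^ i) = 0"
    using n(3,4) by (simp add: left_diff_distrib sum_subtractf)
  moreover have "\<forall>i<n. f i - g i \<in> R" using f g by (auto simp: is_rep_def)
  ultimately have "i < n \<Longrightarrow> f i - g i = 0"
    using ore_free[of n "\<lambda>i. f i - g i" i] by simp
  then show "f i = g i" using n(1,2) by (cases "i < n") auto
qed

lemma is_rep_cf: "is_rep (\<lambda>i. cf i t) t"
proof -
  obtain n rs where *: "\<forall>i<n. rs i \<in> R" "t = (\<Sum>i<n. rs i * x ^ i)"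
    using ore_spans by blast
  have "is_rep (\<lambda>i. if i < n then rs i else 0) t"
    by (rule is_repI[of _ n]) (use * in auto)
  then have "is_rep (THE f. is_rep f t) t"
    by (intro theI[of "\<lambda>f. is_rep f t"]) (auto intro: is_rep_unique)
  moreover have "(\<lambda>i. cf i t) = (THE f. is_rep f t)" by (simp add: cf_def fun_eq_iff)
  ultimately show ?thesis by simp
qed

lemma cf_eqI: "is_rep f t \<Longrightarrow> cf i t = f i"
  using is_rep_unique[OF is_rep_cf[of t], of f] by (simp add: fun_eq_iff)

lemma cf_R [simp, intro]: "cf i t \<in> R"
  using is_rep_cf by (auto simp: is_rep_def)

lemma cf_bounded: "\<exists>n. \<forall>i\<ge>n. cf i t = 0"
  using is_rep_cf[of t] unfolding is_rep_def by blast

lemma cf_expand: "\<forall>i\<ge>n. cf i t = 0 \<Longrightarrow> t = (\<Sum>i<n. cf i t * x ^ i)"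
proof -
  assume n: "\<forall>i\<ge>n. cf i t = 0"
  obtain m where m: "\<forall>i\<ge>m. cf i t = 0" "t = (\<Sum>i<m. cf i t * x ^ i)"
    using is_rep_cf[of t] unfolding is_rep_def by blast
  note m(2)
  also have "(\<Sum>i<m. cf i t * x ^ i) = (\<Sum>i<max m n. cf i t * x ^ i)"
    by (rule sum_extend[OF m(1), symmetric]) simp
  also have "\<dots> = (\<Sum>i<n. cf i t * x ^ i)"
    by (rule sum_extend[OF n]) simp
  finally show ?thesis .
qed

lemma cf_add: "cf i (s + t) = cf i s + cf i t"
proof (rule cf_eqI)
  obtain n where n: "\<forall>i\<ge>n. cf i s = 0" "\<forall>i\<ge>n. cf i t = 0"
    "s = (\<Sum>i<n. cf i s * x ^ i)" "t = (\<Sum>i<n. cf i t * x ^ i)"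
    using is_rep_cf is_rep_cf by (rule is_rep_cong)
  from n(3,4) have "s + t = (\<Sum>i<n. cf i s * x ^ i) + (\<Sum>i<n. cf i t * x ^ i)"
    by (rule arg_cong2)
  then have "s + t = (\<Sum>i<n. (cf i s + cf i t) * x ^ i)"
    by (simp only: distrib_right sum.distrib)
  then show "is_rep (\<lambda>i. cf i s + cf i t) (s + t)"
    by (rule is_repI[rotated 2]) (use n(1,2) in auto)
qed

lemma cf_mult_left:
  assumes "r \<in> R"
  shows "cf i (r * t) = r * cf i t"
proof (rule cf_eqI)
  obtain n where n: "\<forall>i\<ge>n. cf i t = 0" "t = (\<Sum>i<n. cf i t * x ^ i)"
    using is_rep_cf[of t] unfolding is_rep_def by blast
  from n(2) have "r * t = r * (\<Sum>i<n. cf i t * x ^ i)"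
    by (rule arg_cong)
  then have "r * t = (\<Sum>i<n. (r * cf i t) * x ^ i)"
    by (simp only: sum_distrib_left mult.assoc)
  then show "is_rep (\<lambda>i. r * cf i t) (r * t)"
    by (rule is_repI[rotated 2]) (use n(1) assms in auto)
qed

lemma cf_mult_x: "cf i (t * x) = (case i of 0 \<Rightarrow> 0 | Suc j \<Rightarrow> cf j t)"
proof (rule cf_eqI)
  obtain n where n: "\<forall>i\<ge>n. cf i t = 0" "t = (\<Sum>i<n. cf i t * x ^ i)"
    using is_rep_cf[of t] unfolding is_rep_def by blast
  from n(2) have "t * x = (\<Sum>i<n. cf i t * x ^ i) * x"
    by (rule arg_cong)
  also have "\<dots> = (\<Sum>i<n. cf i t * x ^ Suc i)"
    by (simp only: sum_distrib_right mult.assoc power_Suc2)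
  also have "\<dots> = (\<Sum>i<Suc n. (case i of 0 \<Rightarrow> 0 | Suc j \<Rightarrow> cf j t) * x ^ i)"
    by (subst sum.lessThan_Suc_shift) simp
  finally show "is_rep (\<lambda>i. case i of 0 \<Rightarrow> 0 | Suc j \<Rightarrow> cf j t) (t * x)"
    by (rule is_repI[rotated 2]) (use n(1) in \<open>auto split: nat.splits\<close>)
qed

lemma cf_lin: "lin (cf i)"
  by (simp add: klin_end_def cf_add cf_mult_left)

lemma cf_diff: "cf i (s - t) = cf i s - cf i t"
  using cf_add[of i "s - t" t] by simp

lemma lin_cf: "lin f \<Longrightarrow> lin (\<lambda>u. cf i (f u))"
  by (simp add: klin_end_def cf_add cf_mult_left)

lemmas cf_sum = klin_end_sum[OF cf_lin]

lemma cf_of_R: "r \<in> R \<Longrightarrow> cf i r = (if i = 0 then r else 0)"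
  by (rule cf_eqI, rule is_repI[of _ 1]) auto

lemma cf_Rx: "r \<in> R \<Longrightarrow> cf i (r * x) = (if i = 1 then r else 0)"
  by (auto simp: cf_mult_x cf_of_R split: nat.splits)

lemma cf_x: "cf i x = (if i = 1 then 1 else 0)"
  using cf_Rx[of 1 i] by simp

lemma cf_xR: "r \<in> R \<Longrightarrow> cf i (x * r) = (if i = 1 then \<sigma> r else if i = 0 then \<delta> r else 0)"
  by (simp add: x_mult cf_add cf_Rx cf_of_R)

text \<open>Each move of \<open>x\<close> past an element of \<open>R\<close> twists it by
  \<open>\<sigma>\<close> and creates through \<open>\<delta>\<close> a term of lower degree, so
  only the leading coefficient is controlled.\<close>

lemma cf_power_mult:
  "r \<in> R \<Longrightarrow> cf n (x ^ n * r) = (\<sigma> ^^ n) r \<and> (\<forall>i>n. cf i (x ^ n * r) = 0)"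
proof (induction n arbitrary: r)
  case 0
  then show ?case by (simp add: cf_of_R)
next
  case (Suc n)
  have "x ^ Suc n * r = x ^ n * \<sigma> r * x + x ^ n * \<delta> r"
    by (simp add: power_Suc2 mult.assoc x_mult[OF Suc.prems] distrib_left del: power_Suc)
  then have "cf (Suc j) (x ^ Suc n * r) = cf j (x ^ n * \<sigma> r) + cf (Suc j) (x ^ n * \<delta> r)" for j
    by (simp add: cf_add cf_mult_x del: power_Suc)
  then have "cf (Suc j) (x ^ Suc n * r) = (if j = n then (\<sigma> ^^ Suc n) r else 0)" if "j \<ge> n" for j
    using Suc.IH[of "\<sigma> r"] Suc.IH[of "\<delta> r"] Suc.prems that
    by (auto simp: funpow_swap1 simp del: power_Suc)
  then show ?case by (metis Suc_lessE less_irrefl less_or_eq_imp_le order_refl)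
qed

lemma cf_mult_right:
  assumes t: "\<forall>i>d. cf i t = 0" and r: "r \<in> R"
  shows "cf d (t * r) = cf d t * (\<sigma> ^^ d) r" "i > d \<Longrightarrow> cf i (t * r) = 0"
proof -
  have "t = (\<Sum>j<Suc d. cf j t * x ^ j)" using t by (intro cf_expand) auto
  then have "t * r = (\<Sum>j<Suc d. cf j t * x ^ j) * r" by (rule arg_cong)
  then have "t * r = (\<Sum>j<Suc d. cf j t * (x ^ j * r))"
    by (simp only: sum_distrib_right mult.assoc)
  then have *: "cf i (t * r) = (\<Sum>j<Suc d. cf j t * cf i (x ^ j * r))" for i
    by (simp only: cf_sum cf_mult_left[OF cf_R])
  show "cf d (t * r) = cf d t * (\<sigma> ^^ d) r"
    using cf_power_mult[OF r] by (simp add: *)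
  show "i > d \<Longrightarrow> cf i (t * r) = 0"
    using cf_power_mult[OF r] by (simp add: *)
qed

section \<open>Degree arguments for the antipode of \<open>x\<close>\<close>

lemma x_notin_R: "x \<notin> R"
  using cf_of_R[of x 1] by (auto simp: cf_x)

text \<open>If \<open>S x\<close> were in \<open>R\<close>, then \<open>S (S (S x)) = S x\<close>,
  and injectivity of \<open>S\<close> would give \<open>x = S (S x)\<close>, an element of
  \<open>R\<close>.\<close>

lemma S_x_notin_R: "S x \<notin> R"
proof
  assume "S x \<in> R"
  then have "S (S (S x)) = S x" and "S (S x) \<in> R" by (simp_all add: S_S)
  then have "x \<in> R" using S_inj by (metis injD)
  then show False using x_notin_R by simp
qed

text \<open>Let \<open>d > 0\<close> be the degree of \<open>s\<close>. The coefficient of degree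
  \<open>d + 1\<close> comes from \<open>s * P * x\<close> alone and equals the leading coefficient
  of \<open>s\<close> times the \<open>d\<close>-fold \<open>\<sigma>\<close>-twist of
  \<open>P\<close>. It vanishes because the whole sum lies in \<open>R\<close>. The case
  \<open>s = S x\<close> is the antipode identity for \<open>x\<close>.\<close>

lemma top_coefficient_zero:
  assumes s: "s \<notin> R" and R: "c \<in> R" "b \<in> R" "P \<in> R" "q \<in> R"
    and eq: "c * x + s * b + s * P * x + q \<in> R"
  shows "P = 0"
proof -
  obtain n where n: "\<forall>i\<ge>n. cf i s = 0" using cf_bounded by blast
  have "\<exists>i>0. cf i s \<noteq> 0"
  proof (rule ccontr)
    assume "\<not> ?thesis"
    then have "s = (\<Sum>i<1. cf i s * x ^ i)" by (intro cf_expand) (metis less_eq_Suc_le One_nat_def)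
    also have "\<dots> = cf 0 s" by simp
    finally have "s = cf 0 s" .
    then show False using s cf_R[of 0 s] by simp
  qed
  then obtain d0 where "d0 > 0" "cf d0 s \<noteq> 0" by blast
  define d where "d = (GREATEST i. cf i s \<noteq> 0)"
  have le: "i \<le> n" if "cf i s \<noteq> 0" for i using n that by (metis nat_le_linear)
  have d: "cf d s \<noteq> 0" unfolding d_def
    by (rule GreatestI_nat[of "\<lambda>i. cf i s \<noteq> 0" d0 n]) (use le \<open>cf d0 s \<noteq> 0\<close> in auto)
  have d_max: "i \<le> d" if "cf i s \<noteq> 0" for i unfolding d_def
    by (rule Greatest_le_nat[of "\<lambda>i. cf i s \<noteq> 0" i n]) (use le that in auto)
  have "d > 0" using d_max[OF \<open>cf d0 s \<noteq> 0\<close>] \<open>d0 > 0\<close> by simp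
  have top: "\<forall>i>d. cf i s = 0" using d_max by (meson not_le)
  have "cf (Suc d) (c * x + s * b + s * P * x + q) = cf d s * (\<sigma> ^^ d) P"
    using \<open>d > 0\<close> R by (simp add: cf_add cf_Rx cf_of_R cf_mult_x cf_mult_right[OF top])
  then have "cf d s * (\<sigma> ^^ d) P = 0" using cf_of_R[OF eq] by simp
  then show ?thesis using d R_domain[OF cf_R \<sigma>_pow_R] \<sigma>_pow_eq_0 R(3) by blast
qed

section \<open>Shifting the indeterminate by an element of \<open>R\<close>\<close>

lemma cf_shift_power:
  assumes "c \<in> R"
  shows "cf n ((x - c) ^ n) = 1 \<and> (\<forall>i>n. cf i ((x - c) ^ n) = 0)"
proof (induction n)
  case 0
  then show ?case by (simp add: cf_of_R)
next
  case (Suc n)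
  then have "\<forall>i>n. cf i ((x - c) ^ n) = 0" by simp
  note * = cf_mult_right[OF this assms]
  have "cf (Suc i) ((x - c) ^ Suc n) = cf i ((x - c) ^ n) - cf (Suc i) ((x - c) ^ n * c)" for i
    by (simp only: power_Suc2 right_diff_distrib cf_diff cf_mult_x nat.case)
  then have "cf (Suc j) ((x - c) ^ Suc n) = (if j = n then 1 else 0)" if "j \<ge> n" for j
    using Suc * that by (simp del: power_Suc)
  then show ?case by (metis Suc_lessE less_irrefl less_or_eq_imp_le order_refl)
qed

text \<open>Subtracting \<open>c\<close> from \<open>x\<close> cancels an inner derivation, since
  \<open>c\<close> commutes with \<open>\<sigma> r\<close>.\<close>

lemma ore_ext_shift:
  assumes c: "c \<in> R" and inner: "\<And>r. r \<in> R \<Longrightarrow> \<delta> r = c * (r - \<sigma> r)"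
  shows "ore_ext \<iota> R (x - c) \<sigma> (\<lambda>_. 0)"
proof -
  let ?y = "x - c"
  \<comment> \<open>The powers of \<open>x - c\<close> are monic in \<open>x\<close>, so the change
    of basis is triangular: spanning follows by subtracting leading terms, independence by reading
    off top coefficients.\<close>
  note y = cf_shift_power[OF c]
  have comm: "?y * r - \<sigma> r * ?y = 0" if "r \<in> R" for r
    using x_mult[OF that] inner[OF that] R_commute[OF c \<sigma>_R[OF that]] by (simp add: algebra_simps)
  have span: "\<exists>rs. (\<forall>i<n. rs i \<in> R) \<and> t = (\<Sum>i<n. rs i * ?y ^ i)" if "\<forall>i\<ge>n. cf i t = 0" for n t
    using that
  proof (induction n arbitrary: t)
    case 0
    then show ?case using cf_expand[of 0 t] by simp
  next
    case (Suc n)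
    let ?t = "t - cf n t * ?y ^ n"
    have "cf i ?t = 0" if "i \<ge> n" for i
      using that y[of n] Suc.prems by (cases "i = n") (auto simp: cf_diff cf_mult_left)
    then obtain rs where rs: "\<forall>i<n. rs i \<in> R" "?t = (\<Sum>i<n. rs i * ?y ^ i)"
      using Suc.IH by blast
    then have "t = (\<Sum>i<Suc n. (rs(n := cf n t)) i * ?y ^ i)" by (simp add: algebra_simps)
    then show ?case using rs(1) by (intro exI[of _ "rs(n := cf n t)"]) auto
  qed
  have indep: "\<forall>i<n. rs i = 0" if "\<forall>i<n. rs i \<in> R" "(\<Sum>i<n. rs i * ?y ^ i) = 0" for n rs
    using that
  proof (induction n)
    case (Suc n)
    have "cf n (\<Sum>i<Suc n. rs i * ?y ^ i) = (\<Sum>i<Suc n. rs i * cf n (?y ^ i))"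
      unfolding cf_sum using Suc.prems(1) by (intro sum.cong) (auto simp: cf_mult_left)
    also have "\<dots> = rs n" using y by simp
    finally have "rs n = 0" using Suc.prems(2) by (simp add: cf_of_R)
    moreover from this have "\<forall>i<n. rs i = 0" using Suc.prems by (intro Suc.IH) simp_all
    ultimately show ?case by (simp add: less_Suc_eq)
  qed simp
  have "\<exists>n rs. (\<forall>i<n. rs i \<in> R) \<and> t = (\<Sum>i<n. rs i * ?y ^ i)" for t
    using span[of _ t] cf_bounded[of t] by blast
  then show ?thesis
    unfolding ore_ext_def using indep comm \<sigma>_bij \<sigma>_\<iota> \<sigma>_add \<sigma>_mult
    by (simp add: image_subset_iff) blast
qed

section \<open>The quadratic part of the comultiplication vanishes\<close>

lemmas ore_lin_intros = lin_intros lin_cf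

lemma quadratic_part_zero:
  assumes R: "a \<in> R" "b \<in> R" "set v \<subseteq> R \<times> R" "set w \<subseteq> R \<times> R"
    and comult: "tens_eq \<iota> (\<Delta> x) ([(a, x), (x, b)] @ [(u * x, u' * x). (u, u') \<leftarrow> v] @ w)"
    and C: "bilin \<iota> C"
  shows "tsum v C = 0"
proof -
  have C1: "lin f \<Longrightarrow> lin (\<lambda>u. C (f u) y)" and C2: "lin f \<Longrightarrow> lin (\<lambda>y. C u (f y))" for u y f
    using C by (auto simp: bilin_def klin_end_def)
  have v: "p \<in> R" "q \<in> R" if "(p, q) \<in> set v" for p q using that R(3) by auto
  have w: "p \<in> R" "q \<in> R" if "(p, q) \<in> set w" for p q using that R(4) by auto
  have D_x: "tsum (D x) B = B a x + B x b + tsum v (\<lambda>p q. B (p * x) (q * x)) + tsum w B"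
    if "bilin \<iota> B" for B
    using tens_eq_tsum[OF k comult that] D_eq[OF that] by (simp add: algebra_simps)
  \<comment> \<open>Antimultiplicativity of \<open>S\<close> moves \<open>S x\<close> to the front,
    so the quadratic part contributes \<open>S x * P * x\<close> to the antipode identity for
    \<open>x\<close>, and the degree argument forces \<open>P = 0\<close>.\<close>
  define P where "P = tsum v (\<lambda>p q. S p * q)"
  have "P \<in> R" unfolding P_def using v by auto
  have "tsum v (\<lambda>p q. S (p * x) * (q * x)) = S x * P * x"
    unfolding P_def by (simp add: S_mult mult.assoc tsum_mult_left flip: tsum_mult_right)
  then have "S a * x + S x * b + S x * P * x + tsum w (\<lambda>p q. S p * q) = \<iota> (\<epsilon> x)"
    using antipode_left[of x] D_x[of "\<lambda>u v. S u * v"] by (simp add: lin_intros)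
  moreover have "tsum w (\<lambda>p q. S p * q) \<in> R" using w by auto
  ultimately have "P = 0"
    using R \<open>P \<in> R\<close> by (intro top_coefficient_zero[OF S_x_notin_R, of "S a" b P]) auto

  define V W where "V = tsum v (\<lambda>p q. \<iota> (\<epsilon> p) * q)" and "W = tsum w (\<lambda>p q. \<iota> (\<epsilon> p) * q)"
  have "V \<in> R" "W \<in> R" unfolding V_def W_def using v w by auto
  have "tsum v (\<lambda>p q. \<iota> (\<epsilon> (p * x)) * (q * x)) = \<iota> (\<epsilon> x) * V * x"
    unfolding V_def tsum_mult_left[symmetric] tsum_mult_right[symmetric]
    by (simp add: \<epsilon>_mult kalg_mult[OF k] mult.commute[of "\<epsilon> _" "\<epsilon> x"] mult.assoc)
  then have "\<iota> (\<epsilon> a) * x + \<iota> (\<epsilon> x) * b + \<iota> (\<epsilon> x) * V * x + W = x"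
    using counit_left[of x] D_x[of "\<lambda>u v. \<iota> (\<epsilon> u) * v"] by (simp add: lin_intros W_def)
  then have "cf 1 (\<iota> (\<epsilon> a) * x + \<iota> (\<epsilon> x) * b + \<iota> (\<epsilon> x) * V * x + W) = cf 1 x" by simp
  then have "\<iota> (\<epsilon> a) + \<iota> (\<epsilon> x) * V = 1"
    using R \<open>V \<in> R\<close> \<open>W \<in> R\<close> by (simp add: cf_add cf_Rx cf_of_R cf_x)
  then have "\<epsilon> (\<iota> (\<epsilon> a) + \<iota> (\<epsilon> x) * V) = 1" by (simp add: \<epsilon>_1)
  moreover have "\<epsilon> V = \<epsilon> P"
    unfolding V_def P_def by (simp add: \<epsilon>_tsum \<epsilon>_mult \<epsilon>_\<iota> \<epsilon>_S)
  ultimately have "\<epsilon> a = 1" using \<open>P = 0\<close> by (simp add: \<epsilon>_add \<epsilon>_mult \<epsilon>_\<iota> \<epsilon>_0)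
  then have "a \<noteq> 0" by (auto simp: \<epsilon>_0)

  \<comment> \<open>\<open>L\<close> is the image of \<open>v\<close> under the map sending
    \<open>p \<otimes> q\<close> to the sum of \<open>p1 \<otimes> S p2 * q\<close>. This map is
    invertible, so it suffices to show that \<open>L\<close> vanishes.\<close>
  define L where "L = concat (map (\<lambda>(p, q). map (\<lambda>(p1, p2). (p1, S p2 * q)) (D p)) v)"
  have L: "tsum L B = tsum v (\<lambda>p q. tsum (D p) (\<lambda>p1 p2. B p1 (S p2 * q)))" for B :: "'a \<Rightarrow> 'a \<Rightarrow> 'a"
    by (simp add: L_def tsum_concat_map)
  \<comment> \<open>coefficient of \<open>1 \<otimes> x \<otimes> x\<close> in coassociativity, then \<open>p \<otimes> q \<otimes> r \<mapsto> p \<otimes> S(q)r\<close>\<close>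
  have "tsum L (\<lambda>p q. p * \<iota> (g q)) = 0" if g: "klin_fun \<iota> g" for g
  proof -
    let ?\<Phi> = "\<lambda>p q r. p * \<iota> (g (S q * r))"
    let ?F = "\<lambda>p q r. ?\<Phi> (cf 0 p) (cf 1 q) (cf 1 r)"
    note intros = ore_lin_intros lin_fun[OF g]
    have g0: "g 0 = 0" using klin_fun_tsum[OF g, of "[]"] by simp
    have S0: "S 0 = 0" by (rule klin_end_0[OF S_lin])
    note zs = cf_of_R cf_Rx cf_x g0 S0 \<iota>_simps
    have "tsum (D x) (\<lambda>u v. tsum (D u) (\<lambda>p q. ?F p q v)) = tsum (D x) (\<lambda>u v. tsum (D v) (\<lambda>p q. ?F u p q))"
      by (intro D_coassoc intros)
    \<comment> \<open>With the left leg comultiplied, only the quadratic part survives, through the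
      summand \<open>a \<otimes> x\<close> of the inner comultiplication of \<open>x\<close>. Every
      other term has the wrong degree in some leg.\<close>
    moreover have "tsum (D x) (\<lambda>u v. tsum (D u) (\<lambda>p q. ?F p q v))
        = tsum v (\<lambda>p q. tsum (D p) (\<lambda>p1 p2. ?\<Phi> (p1 * a) p2 q))"
    proof -
      have "tsum (D a) (\<lambda>p q. ?F p q x) = 0"
        by (rule tsum_neutral) (use D_R[OF R(1)] in \<open>simp add: zs\<close>)
      moreover have "tsum (D x) (\<lambda>p q. ?F p q b) = 0"
        by (rule tsum_neutral) (use R(2) in \<open>simp add: zs\<close>)
      moreover have "tsum w (\<lambda>u v. tsum (D u) (\<lambda>p q. ?F p q v)) = 0"
        by (intro tsum_neutral) (use w in \<open>simp add: zs\<close>)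
      moreover have "tsum v (\<lambda>p q. tsum (D (p * x)) (\<lambda>r s. ?F r s (q * x)))
          = tsum v (\<lambda>p q. tsum (D p) (\<lambda>p1 p2. ?\<Phi> (p1 * a) p2 q))"
      proof (rule tsum_cong)
        fix p q assume pq: "(p, q) \<in> set v"
        have "tsum (D (p * x)) (\<lambda>r s. ?F r s (q * x))
            = tsum (D p) (\<lambda>p1 p2. tsum (D x) (\<lambda>r s. ?F (p1 * r) (p2 * s) (q * x)))"
          by (intro D_mult intros)
        also have "\<dots> = tsum (D p) (\<lambda>p1 p2. ?\<Phi> (p1 * a) p2 q)"
        proof (rule tsum_cong)
          fix p1 p2 assume "(p1, p2) \<in> set (D p)"
          then have p12: "p1 \<in> R" "p2 \<in> R" using D_R[OF v(1)[OF pq]] by auto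
          have "tsum (D x) (\<lambda>r s. ?F (p1 * r) (p2 * s) (q * x))
              = ?F (p1 * a) (p2 * x) (q * x) + ?F (p1 * x) (p2 * b) (q * x)
                + tsum v (\<lambda>r s. ?F (p1 * (r * x)) (p2 * (s * x)) (q * x))
                + tsum w (\<lambda>r s. ?F (p1 * r) (p2 * s) (q * x))"
            by (intro D_x intros)
          moreover have "tsum v (\<lambda>r s. ?F (p1 * (r * x)) (p2 * (s * x)) (q * x)) = 0"
            by (rule tsum_neutral) (use v p12 in \<open>simp add: zs flip: mult.assoc\<close>)
          moreover have "tsum w (\<lambda>r s. ?F (p1 * r) (p2 * s) (q * x)) = 0"
            by (rule tsum_neutral) (use w p12 in \<open>simp add: zs\<close>)
          ultimately show "tsum (D x) (\<lambda>r s. ?F (p1 * r) (p2 * s) (q * x)) = ?\<Phi> (p1 * a) p2 q"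
            using p12 R v[OF pq] by (simp add: zs)
        qed
        finally show "tsum (D (p * x)) (\<lambda>r s. ?F r s (q * x)) = tsum (D p) (\<lambda>p1 p2. ?\<Phi> (p1 * a) p2 q)" .
      qed
      ultimately show ?thesis
        by (subst D_x) (intro intros, simp)
    qed
    \<comment> \<open>With the right leg comultiplied, only \<open>a\<close> tensored with the
      quadratic part survives, and multiplying \<open>S\<close> of its first leg by its second leg
      produces \<open>P\<close>.\<close>
    moreover have "tsum (D x) (\<lambda>u v. tsum (D v) (\<lambda>p q. ?F u p q)) = a * \<iota> (g P)"
    proof -
      have "tsum (D x) (\<lambda>p q. ?F a p q) = ?F a a x + ?F a x b
          + tsum v (\<lambda>p q. ?F a (p * x) (q * x)) + tsum w (\<lambda>p q. ?F a p q)"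
        by (intro D_x intros)
      moreover have "tsum v (\<lambda>p q. ?F a (p * x) (q * x)) = tsum v (\<lambda>p q. ?\<Phi> a p q)"
        by (rule tsum_cong) (use v R in \<open>simp add: zs\<close>)
      moreover have "tsum w (\<lambda>p q. ?F a p q) = 0"
        by (rule tsum_neutral) (use w in \<open>simp add: zs\<close>)
      moreover have "tsum v (\<lambda>p q. ?\<Phi> a p q) = a * \<iota> (g P)"
        by (simp add: P_def tsum_mult_left klin_fun_tsum[OF g] \<iota>_tsum)
      ultimately have "tsum (D x) (\<lambda>p q. ?F a p q) = a * \<iota> (g P)"
        using R by (simp add: zs)
      moreover have "tsum (D b) (\<lambda>p q. ?F x p q) = 0"
        by (rule tsum_neutral) (simp add: zs)
      moreover have "tsum v (\<lambda>u y. tsum (D (y * x)) (\<lambda>p q. ?F (u * x) p q)) = 0"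
        by (intro tsum_neutral) (use v in \<open>simp add: zs\<close>)
      moreover have "tsum w (\<lambda>u v. tsum (D v) (\<lambda>p q. ?F u p q)) = 0"
      proof (intro tsum_neutral)
        fix u y p q assume "(u, y) \<in> set w" "(p, q) \<in> set (D y)"
        then have "p \<in> R" using w D_R by blast
        then show "?F u p q = 0" by (simp add: zs)
      qed
      ultimately show ?thesis
        by (subst D_x) (intro intros, simp)
    qed
    ultimately have "tsum v (\<lambda>p q. tsum (D p) (\<lambda>p1 p2. ?\<Phi> (p1 * a) p2 q)) = 0"
      using \<open>P = 0\<close> by (simp add: g0 \<iota>_simps)
    moreover have "tsum v (\<lambda>p q. tsum (D p) (\<lambda>p1 p2. ?\<Phi> (p1 * a) p2 q)) = a * tsum L (\<lambda>p q. p * \<iota> (g q))"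
      unfolding L tsum_mult_left[symmetric]
    proof (intro tsum_cong)
      fix p q p1 p2 assume "(p, q) \<in> set v" "(p1, p2) \<in> set (D p)"
      then have "p1 * a = a * p1" using v D_R R_commute[OF R(1)] by metis
      then show "?\<Phi> (p1 * a) p2 q = a * ?\<Phi> p1 p2 q" by (simp add: mult.assoc)
    qed
    moreover have "tsum L (\<lambda>p q. p * \<iota> (g q)) \<in> R"
      unfolding L by (intro R_tsum R_mult R_\<iota>) (use v D_R in blast)
    \<comment> \<open>After contraction by \<open>g\<close> the identity lives in the domain
      \<open>R\<close>, where the nonzero factor \<open>a\<close> cancels.\<close>
    ultimately show ?thesis using R_domain[OF R(1)] \<open>a \<noteq> 0\<close> by auto
  qed
  then have L_zero: "tsum L B = 0" if "bilin \<iota> B" for B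
    using tsum_eqI_right[OF k, of L "[]" B] that by simp
  \<comment> \<open>Evaluating on \<open>L\<close> the composite of \<open>C\<close> with the
    inverse map, which sends \<open>u \<otimes> y\<close> to the sum of
    \<open>u1 \<otimes> u2 * y\<close>, recovers the value of \<open>C\<close> on
    \<open>v\<close>.\<close>
  have "tsum L (\<lambda>u y. tsum (D u) (\<lambda>p q. C p (q * y))) = 0"
    by (intro L_zero lin_intros C1 C2)
  moreover have "tsum L (\<lambda>u y. tsum (D u) (\<lambda>p q. C p (q * y))) = tsum v C"
    unfolding L
  proof (rule tsum_cong)
    fix p q assume "(p, q) \<in> set v"
    have "tsum (D p) (\<lambda>u y. tsum (D u) (\<lambda>r s. C r (s * (S y * q))))
        = tsum (D p) (\<lambda>u y. tsum (D y) (\<lambda>r s. C u (r * (S s * q))))"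
      by (intro D_coassoc lin_intros C1 C2)
    also have "\<dots> = tsum (D p) (\<lambda>u y. C (u * \<iota> (\<epsilon> y)) q)"
    proof (rule tsum_cong)
      fix u y
      have "tsum (D y) (\<lambda>r s. C u (r * (S s * q))) = C u (tsum (D y) (\<lambda>r s. r * S s) * q)"
        unfolding tsum_mult_right[symmetric]
        by (subst klin_end_tsum[OF C2[OF lin_id]]) (simp add: mult.assoc)
      also have "\<dots> = \<iota> (\<epsilon> y) * C u q"
        by (simp add: antipode_right klin_end_scale[OF C2[OF lin_id]])
      also have "\<dots> = C (u * \<iota> (\<epsilon> y)) q"
        by (simp add: klin_end_scale[OF C1[OF lin_id]] flip: kalg_commute[OF k])
      finally show "tsum (D y) (\<lambda>r s. C u (r * (S s * q))) = C (u * \<iota> (\<epsilon> y)) q" .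
    qed
    also have "\<dots> = C p q"
      by (simp add: counit_right flip: klin_end_tsum[OF C1[OF lin_id]])
    finally show "tsum (D p) (\<lambda>u y. tsum (D u) (\<lambda>r s. C r (s * (S y * q)))) = C p q" .
  qed
  ultimately show ?thesis by simp
qed

lemma comult_linear:
  assumes "a \<in> R" "b \<in> R" "set v \<subseteq> R \<times> R" "set w \<subseteq> R \<times> R"
    and comult: "tens_eq \<iota> (\<Delta> x) ([(a, x), (x, b)] @ [(u * x, u' * x). (u, u') \<leftarrow> v] @ w)"
  shows "tens_eq \<iota> (\<Delta> x) ([(a, x), (x, b)] @ w)"
proof (rule tens_eqI[OF k])
  fix B assume B: "bilin \<iota> B"
  have "bilin \<iota> (\<lambda>p q. B (p * x) (q * x))"
    using B by (auto simp: bilin_def klin_end_def distrib_right mult.assoc)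
  then have "tsum v (\<lambda>p q. B (p * x) (q * x)) = 0"
    by (rule quadratic_part_zero[OF assms])
  then show "tsum (\<Delta> x) B = tsum ([(a, x), (x, b)] @ w) B"
    using tens_eq_tsum[OF k comult B] by simp
qed

end

section \<open>Linear comultiplication\<close>

locale hopf_ore_linear = hopf_ore \<iota> \<Delta> \<epsilon> S R x \<sigma> \<delta>
  for \<iota> :: "'k::field \<Rightarrow> 'a::ring_1" and \<Delta> :: "'a \<Rightarrow> ('a \<times> 'a) list"
    and \<epsilon> :: "'a \<Rightarrow> 'k" and S :: "'a \<Rightarrow> 'a" and R :: "'a set"
    and x :: 'a and \<sigma> \<delta> :: "'a \<Rightarrow> 'a" +
  fixes a b :: 'a and w :: "('a \<times> 'a) list"
  assumes a [simp]: "a \<in> R" and b [simp]: "b \<in> R" and w_R: "set w \<subseteq> R \<times> R"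
    and comult: "tens_eq \<iota> (\<Delta> x) ([(a, x), (x, b)] @ w)"
begin

lemma w: assumes "(p, q) \<in> set w" shows "p \<in> R" "q \<in> R"
  using assms w_R by auto

lemma D_x: "bilin \<iota> B \<Longrightarrow> tsum (D x) B = B a x + B x b + tsum w B"
  using tens_eq_tsum[OF k comult] D_eq by (fastforce simp: algebra_simps)

text \<open>This is the coefficient of \<open>x\<close> in the left counit axiom; the right counit
  axiom treats \<open>b\<close> in the same way.\<close>

lemma \<epsilon>_a: "\<epsilon> a = 1"
proof -
  have "tsum w (\<lambda>p q. \<iota> (\<epsilon> p) * q) \<in> R" using w by auto
  moreover have "\<iota> (\<epsilon> a) * x + \<iota> (\<epsilon> x) * b + tsum w (\<lambda>p q. \<iota> (\<epsilon> p) * q) = x"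
    using counit_left[of x] D_x[of "\<lambda>u v. \<iota> (\<epsilon> u) * v"] by (simp add: lin_intros)
  then have "cf 1 (\<iota> (\<epsilon> a) * x + \<iota> (\<epsilon> x) * b + tsum w (\<lambda>p q. \<iota> (\<epsilon> p) * q)) = cf 1 x" by simp
  ultimately have "\<iota> (\<epsilon> a) = \<iota> 1" by (simp add: cf_add cf_Rx cf_of_R cf_x \<iota>_simps)
  then show ?thesis by (rule kalg_inj[OF k])
qed

lemma \<epsilon>_b: "\<epsilon> b = 1"
proof -
  have "tsum w (\<lambda>p q. p * \<iota> (\<epsilon> q)) \<in> R" using w by auto
  moreover have "a * \<iota> (\<epsilon> x) + \<iota> (\<epsilon> b) * x + tsum w (\<lambda>p q. p * \<iota> (\<epsilon> q)) = x"
    using counit_right[of x] D_x[of "\<lambda>u v. u * \<iota> (\<epsilon> v)"]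
    by (simp add: lin_intros kalg_commute[OF k, of _ x])
  then have "cf 1 (a * \<iota> (\<epsilon> x) + \<iota> (\<epsilon> b) * x + tsum w (\<lambda>p q. p * \<iota> (\<epsilon> q))) = cf 1 x" by simp
  ultimately have "\<iota> (\<epsilon> b) = \<iota> 1" by (simp add: cf_add cf_Rx cf_of_R cf_x \<iota>_simps)
  then show ?thesis by (rule kalg_inj[OF k])
qed

text \<open>Take the part of coassociativity for \<open>x\<close> with degrees 0, 0, 1 in the three
  legs: one bracketing leaves the comultiplication of \<open>a\<close> tensored with
  \<open>x\<close>, the other leaves \<open>a \<otimes> a \<otimes> x\<close>.\<close>

lemma grouplike_a: "grouplike \<iota> \<Delta> a"
  unfolding grouplike_def
proof
  show "a \<noteq> 0" using \<epsilon>_a by (auto simp: \<epsilon>_0)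
  show "tens_eq \<iota> (\<Delta> a) [(a, a)]"
  proof (rule tens_eqI[OF k])
    fix B assume B: "bilin \<iota> B"
    have B1: "lin f \<Longrightarrow> lin (\<lambda>u. B (f u) y)" and B2: "lin f \<Longrightarrow> lin (\<lambda>y. B u (f y))" for u y f
      using B by (auto simp: bilin_def klin_end_def)
    have B0: "B u 0 = 0" "B 0 u = 0" for u
      using klin_end_0[OF B1[OF lin_id]] klin_end_0[OF B2[OF lin_id]] by auto
    let ?F = "\<lambda>p q r. B (cf 0 p) (cf 0 q) * cf 1 r"
    note intros = ore_lin_intros B1 B2
    have "tsum (D x) (\<lambda>u v. tsum (D u) (\<lambda>p q. ?F p q v)) = tsum (D x) (\<lambda>u v. tsum (D v) (\<lambda>p q. ?F u p q))"
      by (intro D_coassoc intros)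
    moreover have "tsum (D x) (\<lambda>u v. tsum (D u) (\<lambda>p q. ?F p q v)) = tsum (D a) B"
    proof -
      have "tsum (D a) (\<lambda>p q. ?F p q x) = tsum (D a) B"
        by (rule tsum_cong) (use D_R[OF a] in \<open>simp add: cf_of_R cf_x\<close>)
      moreover have "tsum (D x) (\<lambda>p q. ?F p q b) = 0"
        by (rule tsum_neutral) (simp add: cf_of_R)
      moreover have "tsum w (\<lambda>u v. tsum (D u) (\<lambda>p q. ?F p q v)) = 0"
        by (intro tsum_neutral) (use w in \<open>simp add: cf_of_R\<close>)
      ultimately show ?thesis by (subst D_x) (intro intros, simp)
    qed
    moreover have "tsum (D x) (\<lambda>u v. tsum (D v) (\<lambda>p q. ?F u p q)) = B a a"
    proof -
      have "tsum w (\<lambda>p q. ?F a p q) = 0"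
        by (rule tsum_neutral) (use w in \<open>simp add: cf_of_R\<close>)
      moreover have "tsum (D x) (\<lambda>p q. ?F a p q) = ?F a a x + ?F a x b + tsum w (\<lambda>p q. ?F a p q)"
        by (intro D_x intros)
      ultimately have "tsum (D x) (\<lambda>p q. ?F a p q) = B a a"
        by (simp add: cf_of_R cf_x B0)
      moreover have "tsum (D b) (\<lambda>p q. ?F x p q) = 0"
        by (rule tsum_neutral) (simp add: cf_x B0)
      moreover have "tsum w (\<lambda>u v. tsum (D v) (\<lambda>p q. ?F u p q)) = 0"
      proof (intro tsum_neutral)
        fix u y p q assume "(u, y) \<in> set w" "(p, q) \<in> set (D y)"
        then have "q \<in> R" using w D_R by blast
        then show "?F u p q = 0" by (simp add: cf_of_R)
      qed
      ultimately show ?thesis by (subst D_x) (intro intros, simp)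
    qed
    ultimately show "tsum (\<Delta> a) B = tsum [(a, a)] B" by (simp add: D_eq[OF B])
  qed
qed

text \<open>Mirror image of the argument for \<open>a\<close>, using degrees 1, 0, 0.\<close>

lemma grouplike_b: "grouplike \<iota> \<Delta> b"
  unfolding grouplike_def
proof
  show "b \<noteq> 0" using \<epsilon>_b by (auto simp: \<epsilon>_0)
  show "tens_eq \<iota> (\<Delta> b) [(b, b)]"
  proof (rule tens_eqI[OF k])
    fix B assume B: "bilin \<iota> B"
    have B1: "lin f \<Longrightarrow> lin (\<lambda>u. B (f u) y)" and B2: "lin f \<Longrightarrow> lin (\<lambda>y. B u (f y))" for u y f
      using B by (auto simp: bilin_def klin_end_def)
    have B0: "B u 0 = 0" "B 0 u = 0" for u
      using klin_end_0[OF B1[OF lin_id]] klin_end_0[OF B2[OF lin_id]] by auto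
    let ?F = "\<lambda>p q r. cf 1 p * B (cf 0 q) (cf 0 r)"
    note intros = ore_lin_intros B1 B2
    have "tsum (D x) (\<lambda>u v. tsum (D u) (\<lambda>p q. ?F p q v)) = tsum (D x) (\<lambda>u v. tsum (D v) (\<lambda>p q. ?F u p q))"
      by (intro D_coassoc intros)
    moreover have "tsum (D x) (\<lambda>u v. tsum (D v) (\<lambda>p q. ?F u p q)) = tsum (D b) B"
    proof -
      have "tsum (D b) (\<lambda>p q. ?F x p q) = tsum (D b) B"
        by (rule tsum_cong) (use D_R[OF b] in \<open>simp add: cf_of_R cf_x\<close>)
      moreover have "tsum (D x) (\<lambda>p q. ?F a p q) = 0"
        by (rule tsum_neutral) (simp add: cf_of_R)
      moreover have "tsum w (\<lambda>u v. tsum (D v) (\<lambda>p q. ?F u p q)) = 0"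
        by (intro tsum_neutral) (use w in \<open>simp add: cf_of_R\<close>)
      ultimately show ?thesis by (subst D_x) (intro intros, simp)
    qed
    moreover have "tsum (D x) (\<lambda>u v. tsum (D u) (\<lambda>p q. ?F p q v)) = B b b"
    proof -
      have "tsum w (\<lambda>p q. ?F p q b) = 0"
        by (rule tsum_neutral) (use w in \<open>simp add: cf_of_R\<close>)
      moreover have "tsum (D x) (\<lambda>p q. ?F p q b) = ?F a x b + ?F x b b + tsum w (\<lambda>p q. ?F p q b)"
        by (intro D_x intros)
      ultimately have "tsum (D x) (\<lambda>p q. ?F p q b) = B b b"
        by (simp add: cf_of_R cf_x B0)
      moreover have "tsum (D a) (\<lambda>p q. ?F p q x) = 0"
        by (rule tsum_neutral) (simp add: cf_x B0)
      moreover have "tsum w (\<lambda>u v. tsum (D u) (\<lambda>p q. ?F p q v)) = 0"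
      proof (intro tsum_neutral)
        fix u y p q assume "(u, y) \<in> set w" "(p, q) \<in> set (D u)"
        then have "p \<in> R" using w D_R by blast
        then show "?F p q y = 0" by (simp add: cf_of_R)
      qed
      ultimately show ?thesis by (subst D_x) (intro intros, simp)
    qed
    ultimately show "tsum (\<Delta> b) B = tsum [(b, b)] B" by (simp add: D_eq[OF B])
  qed
qed

section \<open>The automorphism \<open>\<sigma>\<close> as translation by a central
  character\<close>

lemma grouplike_left_inverse:
  assumes "grouplike \<iota> \<Delta> g" "\<epsilon> g = 1"
  shows "S g * g = 1"
proof -
  have "tsum (\<Delta> g) (\<lambda>u v. S u * v) = S g * g"
    using tens_eq_tsum[OF k, of "\<Delta> g" "[(g, g)]" "\<lambda>u v. S u * v"] assms(1)
    by (simp add: grouplike_def lin_intros)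
  then show ?thesis using antipode_left[of g] assms(2) D_eq[of "\<lambda>u v. S u * v" g]
    by (simp add: lin_intros \<iota>_simps)
qed

text \<open>Both sides evaluate \<open>B\<close> on the comultiplication of \<open>x * r\<close>,
  the right one after rewriting it as \<open>\<sigma> r * x + \<delta> r\<close>. Choosing
  \<open>B\<close> to read off coefficients in each leg extracts information on
  \<open>\<sigma>\<close> and on \<open>w\<close>.\<close>

lemma comult_relation:
  assumes r: "r \<in> R" and B: "bilin \<iota> B"
  shows "tsum (D r) (\<lambda>p q. B (a * p) (x * q)) + tsum (D r) (\<lambda>p q. B (x * p) (b * q))
      + tsum w (\<lambda>u v. tsum (D r) (\<lambda>p q. B (u * p) (v * q)))
    = tsum (D (\<sigma> r)) (\<lambda>p q. B (p * a) (q * x)) + tsum (D (\<sigma> r)) (\<lambda>p q. B (p * x) (q * b))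
      + tsum (D (\<sigma> r)) (\<lambda>p q. tsum w (\<lambda>u v. B (p * u) (q * v))) + tsum (D (\<delta> r)) B"
    (is "?l = ?r")
proof -
  have B1: "lin f \<Longrightarrow> lin (\<lambda>u. B (f u) y)" and B2: "lin f \<Longrightarrow> lin (\<lambda>y. B u (f y))" for u y f
    using B by (auto simp: bilin_def klin_end_def)
  have "tsum (D (x * r)) B = tsum (D x) (\<lambda>u v. tsum (D r) (\<lambda>p q. B (u * p) (v * q)))"
    by (rule D_mult[OF B])
  also have "\<dots> = ?l" by (intro D_x lin_intros B1 B2)
  finally have l: "tsum (D (x * r)) B = ?l" .
  have "tsum (D (x * r)) B = tsum (D (\<sigma> r)) (\<lambda>p q. tsum (D x) (\<lambda>u v. B (p * u) (q * v))) + tsum (D (\<delta> r)) B"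
    by (simp add: x_mult[OF r] D_add[OF B] D_mult[OF B])
  also have "tsum (D (\<sigma> r)) (\<lambda>p q. tsum (D x) (\<lambda>u v. B (p * u) (q * v)))
     = tsum (D (\<sigma> r)) (\<lambda>p q. B (p * a) (q * x) + B (p * x) (q * b) + tsum w (\<lambda>u v. B (p * u) (q * v)))"
    by (intro tsum_cong D_x lin_intros B1 B2)
  finally show ?thesis using l by (simp add: tsum_add)
qed

text \<open>Precomposing with \<open>cf 0\<close> makes the character \<open>\<epsilon> \<circ> \<sigma>\<close> of \<open>R\<close> linear on the whole algebra.\<close>

definition \<chi> :: "'a \<Rightarrow> 'k" where
  "\<chi> t = \<epsilon> (\<sigma> (cf 0 t))"

lemma \<chi>_R: "r \<in> R \<Longrightarrow> \<chi> r = \<epsilon> (\<sigma> r)"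
  by (simp add: \<chi>_def cf_of_R)

lemma \<chi>_lin: "klin_fun \<iota> \<chi>"
  by (simp add: klin_fun_def \<chi>_def cf_add cf_mult_left \<sigma>_add \<sigma>_mult \<sigma>_\<iota> \<epsilon>_add \<epsilon>_mult \<epsilon>_\<iota>)

lemma \<sigma>_winding_right:
  assumes r: "r \<in> R"
  shows "\<sigma> r = tsum (D r) (\<lambda>u v. u * \<iota> (\<chi> v))"
proof -
  \<comment> \<open>Degrees 0 and 1 leave the terms \<open>a * p \<otimes> \<sigma> q\<close> from
    \<open>r\<close> and \<open>p * a \<otimes> q\<close> from \<open>\<sigma> r\<close>.
    Multiplying the first leg by \<open>S a\<close> cancels \<open>a\<close>, and the counit removes
    the second leg.\<close>
  let ?B = "\<lambda>u v. S a * cf 0 u * \<iota> (\<epsilon> (cf 1 v))"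
  have Sa: "S a * (a * t) = t" for t
    using grouplike_left_inverse[OF grouplike_a \<epsilon>_a] by (simp flip: mult.assoc)
  have "bilin \<iota> ?B" by (intro ore_lin_intros)
  note rel = comult_relation[OF r this]
  have "tsum (D r) (\<lambda>p q. ?B (a * p) (x * q)) = tsum (D r) (\<lambda>u v. u * \<iota> (\<chi> v))"
    by (rule tsum_cong) (use D_R[OF r] in \<open>simp add: cf_of_R cf_xR Sa \<chi>_R mult.assoc\<close>)
  moreover have "tsum (D r) (\<lambda>p q. ?B (x * p) (b * q)) = 0"
    by (rule tsum_neutral) (use D_R[OF r] in \<open>simp add: cf_of_R \<epsilon>_0 \<iota>_simps\<close>)
  moreover have "tsum w (\<lambda>u v. tsum (D r) (\<lambda>p q. ?B (u * p) (v * q))) = 0"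
    by (intro tsum_neutral) (use D_R[OF r] w in \<open>simp add: cf_of_R \<epsilon>_0 \<iota>_simps\<close>)
  moreover have "tsum (D (\<sigma> r)) (\<lambda>p q. ?B (p * a) (q * x)) = tsum (D (\<sigma> r)) (\<lambda>u v. u * \<iota> (\<epsilon> v))"
    by (rule tsum_cong)
      (use D_R[OF \<sigma>_R[OF r]] R_commute[OF _ a] in \<open>simp add: cf_of_R cf_Rx Sa mult.assoc\<close>)
  moreover have "tsum (D (\<sigma> r)) (\<lambda>p q. ?B (p * x) (q * b)) = 0"
    by (rule tsum_neutral) (use D_R[OF \<sigma>_R[OF r]] in \<open>simp add: cf_of_R \<epsilon>_0 \<iota>_simps\<close>)
  moreover have "tsum (D (\<sigma> r)) (\<lambda>p q. tsum w (\<lambda>u v. ?B (p * u) (q * v))) = 0"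
    by (intro tsum_neutral) (use D_R[OF \<sigma>_R[OF r]] w in \<open>simp add: cf_of_R \<epsilon>_0 \<iota>_simps\<close>)
  moreover have "tsum (D (\<delta> r)) ?B = 0"
    by (rule tsum_neutral) (use D_R[OF \<delta>_R[OF r]] in \<open>simp add: cf_of_R \<epsilon>_0 \<iota>_simps\<close>)
  ultimately show ?thesis using rel by (simp add: counit_right)
qed

lemma \<sigma>_winding_left:
  assumes r: "r \<in> R"
  shows "\<sigma> r = tsum (D r) (\<lambda>u v. \<iota> (\<chi> u) * v)"
proof -
  \<comment> \<open>Degrees 1 and 0 isolate the terms containing \<open>b\<close>, which
    \<open>S b\<close> cancels in the second leg.\<close>
  let ?B = "\<lambda>u v. \<iota> (\<epsilon> (cf 1 u)) * (S b * cf 0 v)"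
  have Sb: "S b * (b * t) = t" for t
    using grouplike_left_inverse[OF grouplike_b \<epsilon>_b] by (simp flip: mult.assoc)
  have "bilin \<iota> ?B" by (intro ore_lin_intros)
  note rel = comult_relation[OF r this]
  have "tsum (D r) (\<lambda>p q. ?B (x * p) (b * q)) = tsum (D r) (\<lambda>u v. \<iota> (\<chi> u) * v)"
    by (rule tsum_cong) (use D_R[OF r] in \<open>simp add: cf_of_R cf_xR Sb \<chi>_R\<close>)
  moreover have "tsum (D r) (\<lambda>p q. ?B (a * p) (x * q)) = 0"
    by (rule tsum_neutral) (use D_R[OF r] in \<open>simp add: cf_of_R \<epsilon>_0 \<iota>_simps\<close>)
  moreover have "tsum w (\<lambda>u v. tsum (D r) (\<lambda>p q. ?B (u * p) (v * q))) = 0"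
    by (intro tsum_neutral) (use D_R[OF r] w in \<open>simp add: cf_of_R \<epsilon>_0 \<iota>_simps\<close>)
  moreover have "tsum (D (\<sigma> r)) (\<lambda>p q. ?B (p * x) (q * b)) = tsum (D (\<sigma> r)) (\<lambda>u v. \<iota> (\<epsilon> u) * v)"
    by (rule tsum_cong)
      (use D_R[OF \<sigma>_R[OF r]] R_commute[OF _ b] in \<open>simp add: cf_of_R cf_Rx Sb\<close>)
  moreover have "tsum (D (\<sigma> r)) (\<lambda>p q. ?B (p * a) (q * x)) = 0"
    by (rule tsum_neutral) (use D_R[OF \<sigma>_R[OF r]] in \<open>simp add: cf_of_R \<epsilon>_0 \<iota>_simps\<close>)
  moreover have "tsum (D (\<sigma> r)) (\<lambda>p q. tsum w (\<lambda>u v. ?B (p * u) (q * v))) = 0"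
    by (intro tsum_neutral) (use D_R[OF \<sigma>_R[OF r]] w in \<open>simp add: cf_of_R \<epsilon>_0 \<iota>_simps\<close>)
  moreover have "tsum (D (\<delta> r)) ?B = 0"
    by (rule tsum_neutral) (use D_R[OF \<delta>_R[OF r]] in \<open>simp add: cf_of_R \<epsilon>_0 \<iota>_simps\<close>)
  ultimately show ?thesis using rel by (simp add: counit_left)
qed

lemma \<sigma>_winding_l: "r \<in> R \<Longrightarrow> \<sigma> r = winding_l \<iota> \<Delta> R \<chi> r"
  using \<sigma>_winding_left[of r] by (simp add: winding_l_def D_def tsum_def)

text \<open>Since \<open>\<sigma>\<close> is both the left and the right winding by
  \<open>\<chi>\<close>, both convolutions of \<open>\<chi>\<close> with a character
  \<open>\<psi>\<close> equal \<open>\<psi> \<circ> \<sigma>\<close>.\<close>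

lemma central_point_\<chi>: "central_point \<iota> \<Delta> R \<chi>"
  unfolding central_point_def
proof (intro conjI allI impI ballI)
  show "character \<iota> R \<chi>"
    by (simp add: character_def \<chi>_R \<sigma>_add \<sigma>_mult \<sigma>_\<iota> \<epsilon>_add \<epsilon>_mult \<epsilon>_\<iota>)
  fix \<psi> r assume \<psi>: "character \<iota> R \<psi>" and r: "r \<in> R"
  have \<psi>_add: "\<psi> (s + t) = \<psi> s + \<psi> t" and \<psi>_mult: "\<psi> (s * t) = \<psi> s * \<psi> t"
    if "s \<in> R" "t \<in> R" for s t using \<psi> that by (auto simp: character_def)
  have \<psi>_\<iota>: "\<psi> (\<iota> c) = c" for c using \<psi> by (auto simp: character_def)
  have "\<psi> 0 = 0" using \<psi>_\<iota>[of 0] by (simp add: \<iota>_simps)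
  note \<psi>_tsum = tsum_additive_on[of R \<psi>, OF \<psi>_add \<open>\<psi> 0 = 0\<close> R_add R_0]
  have "\<psi> (\<sigma> r) = tsum (D r) (\<lambda>u v. \<psi> (\<iota> (\<chi> u) * v))"
    unfolding \<sigma>_winding_left[OF r] by (rule \<psi>_tsum) (use D_R[OF r] in auto)
  also have "\<dots> = tsum (D r) (\<lambda>u v. \<chi> u * \<psi> v)"
    by (rule tsum_cong) (use D_R[OF r] in \<open>simp add: \<psi>_mult \<psi>_\<iota>\<close>)
  finally have "convol \<iota> \<Delta> R \<chi> \<psi> r = \<psi> (\<sigma> r)"
    using r by (simp add: convol_def D_def tsum_def)
  moreover have "\<psi> (\<sigma> r) = tsum (D r) (\<lambda>u v. \<psi> (u * \<iota> (\<chi> v)))"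
    unfolding \<sigma>_winding_right[OF r] by (rule \<psi>_tsum) (use D_R[OF r] in auto)
  moreover have "\<dots> = tsum (D r) (\<lambda>u v. \<psi> u * \<chi> v)"
    by (rule tsum_cong) (use D_R[OF r] in \<open>simp add: \<psi>_mult \<psi>_\<iota>\<close>)
  ultimately show "convol \<iota> \<Delta> R \<chi> \<psi> r = convol \<iota> \<Delta> R \<psi> \<chi> r"
    using r by (simp add: convol_def D_def tsum_def)
qed

text \<open>The algebraic form of: translation by a nontrivial group element has no fixed points.\<close>

lemma displacement_unit:
  assumes r: "r \<in> R"
  shows "tsum (D r) (\<lambda>u v. S u * (v - \<sigma> v)) = \<iota> (\<epsilon> r - \<chi> r)"
proof -
  have "tsum (D r) (\<lambda>u v. S u * \<sigma> v) = tsum (D r) (\<lambda>u v. tsum (D v) (\<lambda>p q. S u * (p * \<iota> (\<chi> q))))"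
    by (rule tsum_cong) (use D_R[OF r] in \<open>simp add: \<sigma>_winding_right tsum_mult_left\<close>)
  also have "\<dots> = tsum (D r) (\<lambda>u v. tsum (D u) (\<lambda>p q. S p * (q * \<iota> (\<chi> v))))"
    by (intro D_coassoc[symmetric] ore_lin_intros lin_fun[OF \<chi>_lin])
  also have "\<dots> = tsum (D r) (\<lambda>u v. \<iota> (\<chi> (\<iota> (\<epsilon> u) * v)))"
    by (simp add: tsum_mult_right antipode_left klin_fun_scale[OF \<chi>_lin] \<iota>_simps flip: mult.assoc)
  also have "\<dots> = \<iota> (\<chi> r)"
    by (simp add: counit_left flip: \<iota>_tsum klin_fun_tsum[OF \<chi>_lin])
  finally have "tsum (D r) (\<lambda>u v. S u * \<sigma> v) = \<iota> (\<chi> r)" .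
  moreover have "\<iota> (\<epsilon> r - \<chi> r) = \<iota> (\<epsilon> r) - \<iota> (\<chi> r)"
    using kalg_add[OF k, of "\<epsilon> r - \<chi> r" "\<chi> r"] by simp
  ultimately show ?thesis by (simp add: right_diff_distrib tsum_diff antipode_left)
qed

section \<open>Innerness of the derivation and vanishing of the inhomogeneous tensor\<close>

lemma displacement_generates:
  assumes "r \<in> R" "\<epsilon> (\<sigma> r) \<noteq> \<epsilon> r"
  obtains zs where "set zs \<subseteq> R \<times> R" "tsum zs (\<lambda>t s. t * (s - \<sigma> s)) = 1"
proof
  \<comment> \<open>Dividing \<open>displacement_unit\<close> by its nonzero scalar gives an
    explicit expression of 1 in the ideal generated by the displacements.\<close>
  let ?c = "inverse (\<epsilon> r - \<chi> r)"
  let ?zs = "map (\<lambda>(u, v). (\<iota> ?c * S u, v)) (D r)"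
  show "set ?zs \<subseteq> R \<times> R" using D_R[OF assms(1)] by auto
  have "tsum ?zs (\<lambda>t s. t * (s - \<sigma> s)) = \<iota> ?c * tsum (D r) (\<lambda>u v. S u * (v - \<sigma> v))"
    by (simp add: mult.assoc flip: tsum_mult_left)
  also have "\<dots> = \<iota> (?c * (\<epsilon> r - \<chi> r))" by (simp only: displacement_unit[OF assms(1)] kalg_mult[OF k])
  also have "\<dots> = 1" using assms by (simp add: \<chi>_R \<iota>_simps)
  finally show "tsum ?zs (\<lambda>t s. t * (s - \<sigma> s)) = 1" .
qed

text \<open>Expanding \<open>\<delta> (r * s) = \<delta> (s * r)\<close> gives the exchange identity
  \<open>\<delta> s * (r - \<sigma> r) = (s - \<sigma> s) * \<delta> r\<close>. Weighting by
  \<open>t\<close> and summing over \<open>zs\<close> turns the right side into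
  \<open>\<delta> r\<close>.\<close>

lemma \<delta>_inner:
  assumes zs: "set zs \<subseteq> R \<times> R" "tsum zs (\<lambda>t s. t * (s - \<sigma> s)) = 1" and r: "r \<in> R"
  shows "\<delta> r = tsum zs (\<lambda>t s. t * \<delta> s) * (r - \<sigma> r)"
proof -
  have "tsum zs (\<lambda>t s. t * \<delta> s) * (r - \<sigma> r) = tsum zs (\<lambda>t s. t * (s - \<sigma> s) * \<delta> r)"
    unfolding tsum_mult_right[symmetric]
  proof (rule tsum_cong)
    fix t s assume "(t, s) \<in> set zs"
    then have s: "s \<in> R" using zs by auto
    have "\<sigma> r * \<delta> s + \<delta> r * s = \<sigma> s * \<delta> r + \<delta> s * r"
      using \<delta>_mult[OF r s] \<delta>_mult[OF s r] R_commute[OF r s] by simp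
    then have "\<delta> s * (r - \<sigma> r) = (s - \<sigma> s) * \<delta> r"
      using R_commute[of "\<sigma> r" "\<delta> s"] R_commute[of "\<delta> r" s] r s
      by (simp add: algebra_simps)
    then show "t * \<delta> s * (r - \<sigma> r) = t * (s - \<sigma> s) * \<delta> r" by (simp add: mult.assoc)
  qed
  then show ?thesis using zs(2) by (simp add: tsum_mult_right)
qed

lemma inhomogeneous_part_zero:
  assumes zs: "set zs \<subseteq> R \<times> R" "tsum zs (\<lambda>t s. t * (s - \<sigma> s)) = 1"
    and \<delta>: "\<And>r. r \<in> R \<Longrightarrow> \<delta> r = 0" and C: "bilin \<iota> C"
  shows "tsum w C = 0"
proof -
  \<comment> \<open>\<open>G C r\<close> is the value of \<open>C\<close> on the product of the
    comultiplication of \<open>r\<close> with \<open>w\<close>. It is kept general in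
    \<open>C\<close> so that a further left factor can be absorbed into \<open>C\<close>.\<close>
  define G where "G = (\<lambda>C r. tsum (D r) (\<lambda>p q. tsum w (\<lambda>u v. C (p * u) (q * v) :: 'a)))"
  have C1: "lin f \<Longrightarrow> lin (\<lambda>u. C (f u) y)" and C2: "lin f \<Longrightarrow> lin (\<lambda>y. C u (f y))"
    if "bilin \<iota> C" for C u y f
    using that by (auto simp: bilin_def klin_end_def)
  have G_lin: "lin (G C)" if "bilin \<iota> C" for C
    unfolding G_def by (intro lin_intros C1[OF that] C2[OF that])
  \<comment> \<open>With \<open>\<delta> = 0\<close>, the part of \<open>comult_relation\<close> of
    degree 0 in both legs retains only the two terms with \<open>w\<close>.\<close>
  have G_\<sigma>: "G C r = G C (\<sigma> r)" if C: "bilin \<iota> C" and r: "r \<in> R" for C r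
  proof -
    let ?B = "\<lambda>u v. C (cf 0 u) (cf 0 v)"
    have C0: "C u 0 = 0" "C 0 u = 0" for u
      using klin_end_0[OF C1[OF C lin_id]] klin_end_0[OF C2[OF C lin_id]] by auto
    have "bilin \<iota> ?B" by (intro ore_lin_intros C1[OF C] C2[OF C])
    note rel = comult_relation[OF r this]
    have "tsum (D r) (\<lambda>p q. ?B (a * p) (x * q)) = 0" "tsum (D r) (\<lambda>p q. ?B (x * p) (b * q)) = 0"
      by (rule tsum_neutral; use D_R[OF r] in \<open>simp add: cf_xR \<delta> C0\<close>)+
    moreover have "tsum (D (\<sigma> r)) (\<lambda>p q. ?B (p * a) (q * x)) = 0"
      "tsum (D (\<sigma> r)) (\<lambda>p q. ?B (p * x) (q * b)) = 0"
      by (rule tsum_neutral; use D_R[OF \<sigma>_R[OF r]] in \<open>simp add: cf_Rx C0\<close>)+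
    \<comment> \<open>\<open>D 0\<close> is a chosen representative of the zero tensor that may be a
      nonempty list, so the value is obtained from linearity.\<close>
    moreover have "tsum (D (\<delta> r)) ?B = 0"
      using D_scale[OF \<open>bilin \<iota> ?B\<close>, of 0 0] by (simp add: \<delta>[OF r] \<iota>_simps)
    moreover have "tsum w (\<lambda>u v. tsum (D r) (\<lambda>p q. ?B (u * p) (v * q))) = G C r"
      unfolding G_def
    proof (subst tsum_swap, intro tsum_cong)
      fix p q u v assume "(p, q) \<in> set (D r)" "(u, v) \<in> set w"
      then have "p \<in> R" "q \<in> R" "u \<in> R" "v \<in> R" using D_R[OF r] w by auto
      then show "?B (u * p) (v * q) = C (p * u) (q * v)"
        using R_commute[of u p] R_commute[of v q] by (simp add: cf_of_R)
    qed
    moreover have "tsum (D (\<sigma> r)) (\<lambda>p q. tsum w (\<lambda>u v. ?B (p * u) (q * v))) = G C (\<sigma> r)"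
      unfolding G_def
      by (intro tsum_cong) (use D_R[OF \<sigma>_R[OF r]] w in \<open>simp add: cf_of_R\<close>)
    ultimately show ?thesis using rel by simp
  qed
  have "G C (t * (s - \<sigma> s)) = 0" if "t \<in> R" "s \<in> R" for t s
  proof -
    have "G C (t * (s - \<sigma> s)) = tsum (D t) (\<lambda>p q. G (\<lambda>u v. C (p * u) (q * v)) (s - \<sigma> s))"
      unfolding G_def by (subst D_mult) (intro lin_intros C1[OF C] C2[OF C], simp add: mult.assoc)
    also have "\<dots> = 0"
    proof (rule tsum_neutral)
      fix p q
      have b: "bilin \<iota> (\<lambda>u v. C (p * u) (q * v))" by (intro lin_intros C1[OF C] C2[OF C])
      have "G (\<lambda>u v. C (p * u) (q * v)) (s - \<sigma> s + \<sigma> s) =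
          G (\<lambda>u v. C (p * u) (q * v)) (s - \<sigma> s) + G (\<lambda>u v. C (p * u) (q * v)) (\<sigma> s)"
        by (rule klin_end_add[OF G_lin[OF b]])
      then show "G (\<lambda>u v. C (p * u) (q * v)) (s - \<sigma> s) = 0"
        using G_\<sigma>[OF b \<open>s \<in> R\<close>] by simp
    qed
    finally show ?thesis .
  qed
  \<comment> \<open>The displacements generate the unit ideal, so \<open>G C\<close> vanishes at 1,
    where its value is that of \<open>C\<close> on \<open>w\<close>.\<close>
  then have "tsum zs (\<lambda>t s. G C (t * (s - \<sigma> s))) = 0"
    using zs(1) by (intro tsum_neutral) auto
  then have "G C 1 = 0" using klin_end_tsum[OF G_lin[OF C]] zs(2) by metis
  moreover have "G C 1 = tsum w C"
    unfolding G_def by (subst D_one) (intro lin_intros C1[OF C] C2[OF C], simp)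
  ultimately show ?thesis by simp
qed

end

section \<open>The change of variable in the variant case\<close>

theorem theorem5p2:
  fixes \<iota> :: "'k::field_char_0 \<Rightarrow> 'a::ring_1"
    and \<Delta> :: "'a \<Rightarrow> ('a \<times> 'a) list" and \<epsilon> :: "'a \<Rightarrow> 'k" and S :: "'a \<Rightarrow> 'a"
    and R :: "'a set" and x :: 'a and \<sigma> \<delta> :: "'a \<Rightarrow> 'a"
  assumes "alg_closed_field TYPE('k)"
    and "affine_comm_domain \<iota> R"
    and "hopf_ore_ext \<iota> \<Delta> \<epsilon> S R x \<sigma> \<delta>"
    and "variant_type \<iota> R \<sigma> \<delta>"
  shows "\<exists>r\<in>R. ore_ext \<iota> R (x + r) \<sigma> (\<lambda>_. 0)
           \<and> skew_primitive \<iota> \<Delta> (x + r)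
           \<and> (\<exists>\<chi>. central_point \<iota> \<Delta> R \<chi> \<and>
                ((\<forall>f\<in>R. \<sigma> f = winding_l \<iota> \<Delta> R \<chi> f) \<or> (\<forall>f\<in>R. \<sigma> f = winding_r \<iota> \<Delta> R \<chi> f)))"
proof -
  obtain a b v w where ext: "hopf_alg \<iota> \<Delta> \<epsilon> S" "hopf_subalg \<iota> \<Delta> S R" "ore_ext \<iota> R x \<sigma> \<delta>"
    and abvw: "a \<in> R" "b \<in> R" "set v \<subseteq> R \<times> R" "set w \<subseteq> R \<times> R"
      "tens_eq \<iota> (\<Delta> x) ([(a, x), (x, b)] @ [(u * x, u' * x). (u, u') \<leftarrow> v] @ w)"
    using assms(3) unfolding hopf_ore_ext_def by blast
  interpret hopf_ore \<iota> \<Delta> \<epsilon> S R x \<sigma> \<delta>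
    by unfold_locales (use ext assms(2) in \<open>auto simp: affine_comm_domain_def\<close>)
  interpret X: hopf_ore_linear \<iota> \<Delta> \<epsilon> S R x \<sigma> \<delta> a b w
    by unfold_locales (use abvw comult_linear[OF abvw] in auto)
  have "\<exists>r\<in>R. \<epsilon> (\<sigma> r) \<noteq> \<epsilon> r"
  proof (rule ccontr)
    assume "\<not> ?thesis"
    then have inv: "\<epsilon> (\<sigma> r) = \<epsilon> r" if "r \<in> R" for r using that by blast
    \<comment> \<open>Variance is tested at the augmentation ideal: were \<open>\<epsilon>\<close>
      invariant under \<open>\<sigma>\<close> on \<open>R\<close>, bijectivity of
      \<open>\<sigma>\<close> would make the intersection of this ideal with \<open>R\<close>
      stable.\<close>
    let ?M = "{t. \<epsilon> t = 0}"
    have "\<sigma> ` (?M \<inter> R) = ?M \<inter> R"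
    proof
      show "\<sigma> ` (?M \<inter> R) \<subseteq> ?M \<inter> R" using inv by auto
      show "?M \<inter> R \<subseteq> \<sigma> ` (?M \<inter> R)"
      proof
        fix r assume r: "r \<in> ?M \<inter> R"
        then obtain s where "s \<in> R" "r = \<sigma> s" using \<sigma>_bij by (auto simp: bij_betw_def)
        then show "r \<in> \<sigma> ` (?M \<inter> R)" using r inv by auto
      qed
    qed
    moreover have "?M \<in> Xi \<iota>"
      unfolding Xi_def kalg_hom_to_k_def using \<epsilon>_add \<epsilon>_mult \<epsilon>_\<iota> by blast
    ultimately show False using assms(4) by (auto simp: variant_type_def)
  qed
  then obtain zs where zs: "set zs \<subseteq> R \<times> R" "tsum zs (\<lambda>t s. t * (s - \<sigma> s)) = 1"
    using X.displacement_generates by blast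
  define c where "c = tsum zs (\<lambda>t s. t * \<delta> s)"
  have c: "c \<in> R" unfolding c_def using zs(1) by auto
  have ore': "ore_ext \<iota> R (x - c) \<sigma> (\<lambda>_. 0)"
    using X.\<delta>_inner[OF zs] unfolding c_def[symmetric] by (rule ore_ext_shift[OF c])
  \<comment> \<open>These are the corrections in the comultiplication of \<open>x - c\<close>:
    replacing \<open>x\<close> by \<open>x - c\<close> in the two linear terms adds
    \<open>a \<otimes> c\<close> and \<open>c \<otimes> b\<close>, and the comultiplication of
    \<open>c\<close> is subtracted by negating left legs.\<close>
  define w' where "w' = w @ [(a, c), (c, b)] @ map (\<lambda>(u, v). (- u, v)) (D c)"
  have comult': "tens_eq \<iota> (\<Delta> (x - c)) ([(a, x - c), (x - c, b)] @ w')"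
  proof (rule tens_eqI[OF k])
    fix B assume B: "bilin \<iota> B"
    have B1: "lin (\<lambda>u. B u y)" and B2: "lin (\<lambda>y. B u y)" for u y
      using B by (auto simp: bilin_def)
    have minus: "B (- u) y = - B u y" for u y
      using klin_end_add[OF B1, of u "- u"] klin_end_0[OF B1]
      by (simp add: eq_neg_iff_add_eq_0 add.commute)
    have diff: "B (u - u') y = B u y - B u' y" "B u (y - y') = B u y - B u y'" for u u' y y'
      using klin_end_add[OF B1, of "u - u'" u'] klin_end_add[OF B2, of _ "y - y'" y'] by simp_all
    have "tsum (D c) (\<lambda>u v. B (- u) v) = - tsum (D c) B"
      using tsum_diff[of "D c" "\<lambda>_ _. 0" B] by (simp add: minus)
    moreover have "tsum (D x) B = tsum (D (x - c)) B + tsum (D c) B"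
      using D_add[OF B, of "x - c" c] by simp
    ultimately show "tsum (\<Delta> (x - c)) B = tsum ([(a, x - c), (x - c, b)] @ w') B"
      using X.D_x[OF B] by (simp add: D_eq[OF B] w'_def diff algebra_simps)
  qed
  \<comment> \<open>The linear theory is applied again to the new indeterminate, whose derivation is
    zero. Since \<open>\<sigma>\<close>, and with it \<open>zs\<close>, is unchanged,
    \<open>w'\<close> must vanish.\<close>
  interpret Y: hopf_ore_linear \<iota> \<Delta> \<epsilon> S R "x - c" \<sigma> "\<lambda>_. 0" a b w'
  proof unfold_locales
    show "set w' \<subseteq> R \<times> R" unfolding w'_def using abvw c D_R[OF c] by auto
  qed (fact ore' comult' abvw)+
  have "tens_eq \<iota> (\<Delta> (x - c)) [(a, x - c), (x - c, b)]"
  proof (rule tens_eqI[OF k])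
    fix B assume B: "bilin \<iota> B"
    show "tsum (\<Delta> (x - c)) B = tsum [(a, x - c), (x - c, b)] B"
      using tens_eq_tsum[OF k comult' B] Y.inhomogeneous_part_zero[OF zs refl B] by simp
  qed
  then have "skew_primitive \<iota> \<Delta> (x - c)"
    unfolding skew_primitive_def using X.grouplike_a X.grouplike_b by blast
  then show ?thesis
    using ore' c X.central_point_\<chi> X.\<sigma>_winding_l by (intro bexI[of _ "- c"]) auto
qed

end
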